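(* Let $n>0$ and let $U=\mathbb C^2$ be the symplectic plane, $V=S^{2n+1}U$. For every $W\in\mathcal W$ there exists a nondegenerate antisymmetric (symplectic) form $f=f_W:\bigwedge^2V\to\mathbb C$ such that, for every $t\in\mathbb C^*$, $${}^T\sigma_1 f\sigma_1=a f\ \text{ for some } a\in\mathbb C^*\ (\sigma_1=\mathrm{diag}(t^\alpha,t^\beta)),\qquad\text{and}\qquad\langle f,w\rangle=0\ \text{ for all } w\in W.$$ There also exists a $\mathbb C^*$-invariant subspace $D_W\subset\bigwedge^2V$ (containing $f$, regarded as an element of $\bigwedge^2V$) such that $\bigwedge^2V\simeq D_W\oplus W$. In this case one obtains an exact sequence on $\mathbb P(V)$ $$0\to N(f)(-1)\to\left(D_W/\mathbb C f\right)\otimes\mathcal O_{\mathbb P(V)}\to F(W)(1)\to0,$$ where $N(f)$ is the special classical null correlation bundle associated with $f$ and $F(W)$ is the Tango bundle associated with $W$.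
   Context: $\alpha\in\mathbb N$, $\beta\in\mathbb Z$ with $\alpha\ge\beta$, $\alpha+\beta\ge0$. $U$ has basis $x,y$; $\mathbb C^*$ acts on $U$ by $\sigma_1(t)=\mathrm{diag}(t^\alpha,t^\beta)$, hence on $V=S^{2n+1}U$ (basis $x^{2n+1-j}y^j$, $0\le j\le2n+1$) and on $\bigwedge^2V$. For $1\le k\le4n+1$ let $E_k\subset\bigwedge^2V$ be spanned by $x^{2n+1-p}y^p\wedge x^{2n+1-q}y^q$, $p<q$, $p+q=k$; $\bigwedge^2 V=\bigoplus_k E_k$. $\mathcal W$ is the set of $\mathbb C^*$-invariant subspaces $W\subset\bigwedge^2V$ of dimension $\binom{2n+2}{2}-4n-1$ containing no nonzero decomposable element $u\wedge v$; invariance means $W=\bigoplus_k(W\cap E_k)$. Symplectic plane: $\langle x,x\rangle=\langle y,y\rangle=0$, $\langle x,y\rangle=-1$. It induces on $S^mU$ the form with $\langle x^iy^{m-i},x^jy^{m-j}\rangle=(-1)^ii!\,j!$ if $i+j=m$ and $0$ otherwise, and on $\bigwedge^2S^{2n+1}U$ the nondegenerate symmetric form given, for $z_{i,j}=x^iy^{2n+1-i}\wedge x^jy^{2n+1-j}$ ($i<j$) and $z_{s,t}$ similarly ($s<t$), by $\langle z_{i,j},z_{s,t}\rangle=(-1)^{i+j+1}i!\,t!\,j!\,s!$ if $j+s=2n+1$ and $i+t=2n+1$, and $0$ otherwise. Via this form, linear forms $f$ on $\bigwedge^2V$ are identified with elements $f\in\bigwedge^2V$: $f(g)=\langle f,g\rangle$.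 Linear forms on $\bigwedge^2V$ are identified with antisymmetric maps $V\to V^*$. $\mathbb P(V)$ is the space of lines of $V$; $0\to\mathcal O(-1)\xrightarrow{g}V\otimes\mathcal O\to Q\to0$ is the tautological sequence. For an antisymmetric isomorphism $f:V\to V^*$, the classical null correlation bundle $N(f)$ is the kernel of the surjection $Q\to\mathcal O(1)$ induced by ${}^Tg\circ f$. It is called special if, in the basis $(x^{2n+1-j}y^j)_j$, the matrix of $f$ is antidiagonal, with antidiagonal entries $-r_0,\dots,-r_n$ in rows $1,\dots,n+1$ and $r_n,\dots,r_0$ in rows $n+2,\dots,2n+2$, all $r_i\in\mathbb C^*$. The Tango bundle $F(W)$ is defined by the exact sequence $0\to Q(-1)\xrightarrow{\varpi_W}(\bigwedge^2V/W)\otimes\mathcal O\to F(W)(1)\to0$, where $\varpi_W$ at the line $\mathbb Cv$ is $\bar u\otimes v\mapsto v\wedge u$ mod $W$.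
   Formalization: The isomorphism of ⋀²V with D_W ⊕ W is proved as a graded isomorphism with the external direct sum; D_W is shown to be an actual complement of W exactly when f is not in W, since an isotropic f can lie in W (e.g. n=1, W spanned by z_{0,3}+3i z_{1,2}). *)

theory Defs
  imports Complex_Main "HOL-Library.Function_Algebras"
begin

section \<open>Complex coordinate spaces\<close>

definition cscale :: "complex \<Rightarrow> ('i \<Rightarrow> complex) \<Rightarrow> 'i \<Rightarrow> complex" (infixr "*\<^sub>C" 75)
  where "c *\<^sub>C u = (\<lambda>i. c * u i)"

global_interpretation cvec: vector_space cscale
  by unfold_locales (auto simp: cscale_def fun_eq_iff algebra_simps)

type_synonym cvector = "nat \<Rightarrow> complex"
type_synonym cbivector = "nat \<times> nat \<Rightarrow> complex"

section \<open>Symmetric powers of the plane and their exterior squares\<close>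

text \<open>A binary form of degree \<open>m\<close> is given by its coefficients:
  \<open>u j\<close> is the coefficient of \<open>x^(m - j) y^j\<close>.\<close>

definition Sym :: "nat \<Rightarrow> cvector set"
  where "Sym m = {u. \<forall>j>m. u j = 0}"

definition monom_vec :: "nat \<Rightarrow> cvector"
  where "monom_vec j = (\<lambda>i. if i = j then 1 else 0)"

definition sigma1 :: "nat \<Rightarrow> int \<Rightarrow> nat \<Rightarrow> complex \<Rightarrow> cvector \<Rightarrow> cvector"
  where "sigma1 \<alpha> \<beta> m t u = (\<lambda>j. (t ^ \<alpha>) ^ (m - j) * (t powi \<beta>) ^ j * u j)"

text \<open>Bivectors are antisymmetric arrays; for \<open>p < q\<close> the entry at \<open>(p, q)\<close> is the coefficient
  of \<open>wedge (monom_vec p) (monom_vec q)\<close>.\<close>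

definition wedge :: "cvector \<Rightarrow> cvector \<Rightarrow> cbivector"
  where "wedge u v = (\<lambda>(p, q). u p * v q - u q * v p)"

definition Ext2 :: "nat \<Rightarrow> cbivector set"
  where "Ext2 m = cvec.span {wedge u v | u v. u \<in> Sym m \<and> v \<in> Sym m}"

definition E :: "nat \<Rightarrow> nat \<Rightarrow> cbivector set"
  where "E m k = cvec.span {wedge (monom_vec p) (monom_vec q) | p q. p < q \<and> q \<le> m \<and> p + q = k}"

definition torus_invariant :: "nat \<Rightarrow> cbivector set \<Rightarrow> bool"
  where "torus_invariant m W \<longleftrightarrow>
    W \<subseteq> Ext2 m \<and> cvec.subspace W \<and> W = cvec.span (\<Union>k\<in>{1..2 * m - 1}. W \<inter> E m k)"

definition tango_subspaces :: "nat \<Rightarrow> cbivector set set"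
  where "tango_subspaces n = {W. torus_invariant (2 * n + 1) W \<and>
    cvec.dim W = ((2 * n + 2) choose 2) - 4 * n - 1 \<and>
    (\<forall>u\<in>Sym (2 * n + 1). \<forall>v\<in>Sym (2 * n + 1). wedge u v \<noteq> 0 \<longrightarrow> wedge u v \<notin> W)}"

definition internal_direct_sum :: "('i \<Rightarrow> complex) set \<Rightarrow> ('i \<Rightarrow> complex) set \<Rightarrow> ('i \<Rightarrow> complex) set \<Rightarrow> bool"
  where "internal_direct_sum X D W \<longleftrightarrow> D \<inter> W = {0} \<and> X = {d + w | d w. d \<in> D \<and> w \<in> W}"

text \<open>An isomorphism of the exterior direct sum of \<open>D\<close> and \<open>W\<close> with the exterior square.
  Equivariance is expressed, as invariance is, through the decomposition into the \<open>E m k\<close>.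
  The sum has to be an external one if \<open>D\<close> is to contain a form \<open>f\<close> orthogonal to \<open>W\<close>: such an
  \<open>f\<close> may be isotropic, and then it lies in \<open>W\<close>.\<close>

definition direct_sum_iso :: "nat \<Rightarrow> cbivector set \<Rightarrow> cbivector set
    \<Rightarrow> (cbivector \<times> cbivector \<Rightarrow> cbivector) \<Rightarrow> bool"
  where "direct_sum_iso m D W \<Phi> \<longleftrightarrow>
    bij_betw \<Phi> (D \<times> W) (Ext2 m) \<and>
    (\<forall>d\<in>D. \<forall>d'\<in>D. \<forall>w\<in>W. \<forall>w'\<in>W. \<Phi> (d + d', w + w') = \<Phi> (d, w) + \<Phi> (d', w')) \<and>
    (\<forall>c. \<forall>d\<in>D. \<forall>w\<in>W. \<Phi> (c *\<^sub>C d, c *\<^sub>C w) = c *\<^sub>C \<Phi> (d, w)) \<and>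
    (\<forall>k\<in>{1..2 * m - 1}. \<forall>d\<in>D \<inter> E m k. \<forall>w\<in>W \<inter> E m k. \<Phi> (d, w) \<in> E m k)"

section \<open>The symmetric form and antisymmetric forms\<close>

text \<open>The formula below is the bilinear extension of its values on
  \<open>z i j = wedge (x^i y^(m-i)) (x^j y^(m-j))\<close>, \<open>i < j\<close>. As \<open>x^i y^(m-i)\<close> is
  \<open>monom_vec (m - i)\<close>, the coefficient of \<open>z i j\<close> in \<open>f\<close> is \<open>f (m - i, m - j)\<close>.\<close>

definition zvec :: "nat \<Rightarrow> nat \<Rightarrow> nat \<Rightarrow> cbivector"
  where "zvec m i j = wedge (monom_vec (m - i)) (monom_vec (m - j))"

definition ext_form :: "nat \<Rightarrow> cbivector \<Rightarrow> cbivector \<Rightarrow> complex"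
  where "ext_form m f g =
    (\<Sum>(i, j)\<in>{(i, j). i < j \<and> j \<le> m}. \<Sum>(s, t)\<in>{(s, t). s < t \<and> t \<le> m}.
      (if j + s = m \<and> i + t = m then (- 1) ^ (i + j + 1) * fact i * fact t * fact j * fact s else 0)
      * f (m - i, m - j) * g (m - s, m - t))"

lemma ext_form_zvec:
  assumes "i < j" "j \<le> m" "s < t" "t \<le> m"
  shows "ext_form m (zvec m i j) (zvec m s t) =
    (if j + s = m \<and> i + t = m then (- 1) ^ (i + j + 1) * fact i * fact t * fact j * fact s else 0)"
proof -
  let ?P = "{(i, j). i < j \<and> j \<le> m}"
  let ?c = "\<lambda>i j s t. if j + s = m \<and> i + t = m
    then (- 1) ^ (i + j + 1) * fact i * fact t * fact j * fact s else 0 :: complex"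
  have fin: "finite ?P"
    by (rule finite_subset[of _ "{..m} \<times> {..m}"]) auto
  have z: "zvec m a b (m - c, m - d) = (if (c, d) = (a, b) then 1 else 0)"
    if "a < b" "b \<le> m" "c < d" "d \<le> m" for a b c d
    using that by (auto simp: zvec_def wedge_def monom_vec_def)
  have "ext_form m (zvec m i j) (zvec m s t) =
    (\<Sum>x\<in>?P. \<Sum>y\<in>?P. if x = (i, j) then if y = (s, t) then ?c i j s t else 0 else 0)"
    unfolding ext_form_def
  proof (intro sum.cong refl, clarify)
    fix a b :: nat assume ab: "a < b" "b \<le> m"
    show "(\<Sum>(c, d)\<in>?P. ?c a b c d * zvec m i j (m - a, m - b) * zvec m s t (m - c, m - d)) =
      (\<Sum>y\<in>?P. if (a, b) = (i, j) then if y = (s, t) then ?c i j s t else 0 else 0)"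
    proof (intro sum.cong refl, clarify)
      fix c d :: nat assume cd: "c < d" "d \<le> m"
      show "?c a b c d * zvec m i j (m - a, m - b) * zvec m s t (m - c, m - d) =
        (if (a, b) = (i, j) then if (c, d) = (s, t) then ?c i j s t else 0 else 0)"
        unfolding z[OF assms(1,2) ab] z[OF assms(3,4) cd] by auto
    qed
  qed
  also have "\<dots> = (\<Sum>x\<in>?P. if x = (i, j) then \<Sum>y\<in>?P. if y = (s, t) then ?c i j s t else 0 else 0)"
    by (intro sum.cong refl) auto
  also have "\<dots> = ?c i j s t"
    using assms fin by (simp add: sum.delta)
  finally show ?thesis .
qed

text \<open>An element \<open>f\<close> of the exterior square stands for the linear form \<open>ext_form m f\<close>, and for
  the antisymmetric map sending \<open>u\<close> to the functional \<open>bilin m f u\<close>.\<close>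

definition bilin :: "nat \<Rightarrow> cbivector \<Rightarrow> cvector \<Rightarrow> cvector \<Rightarrow> complex"
  where "bilin m f u v = ext_form m f (wedge u v)"

definition nondegenerate :: "nat \<Rightarrow> cbivector \<Rightarrow> bool"
  where "nondegenerate m f \<longleftrightarrow> (\<forall>u\<in>Sym m. (\<forall>v\<in>Sym m. bilin m f u v = 0) \<longrightarrow> u = 0)"

definition special :: "nat \<Rightarrow> cbivector \<Rightarrow> bool"
  where "special n f \<longleftrightarrow> (\<exists>r :: nat \<Rightarrow> complex. (\<forall>i\<le>n. r i \<noteq> 0) \<and>
    (\<forall>i\<le>2 * n + 1. \<forall>j\<le>2 * n + 1. bilin (2 * n + 1) f (monom_vec i) (monom_vec j) =
      (if i + j = 2 * n + 1 then if i \<le> n then - r i else r (2 * n + 1 - i) else 0)))"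

section \<open>Vector bundles on the projective space of lines\<close>

inductive homogeneous_poly :: "nat \<Rightarrow> (cvector \<Rightarrow> complex) \<Rightarrow> bool" where
  hp_const: "homogeneous_poly 0 (\<lambda>_. c)"
| hp_coord: "homogeneous_poly 1 (\<lambda>v. v j)"
| hp_add: "homogeneous_poly d p \<Longrightarrow> homogeneous_poly d q \<Longrightarrow> homogeneous_poly d (\<lambda>v. p v + q v)"
| hp_mult: "homogeneous_poly d p \<Longrightarrow> homogeneous_poly e q \<Longrightarrow> homogeneous_poly (d + e) (\<lambda>v. p v * q v)"

abbreviation line :: "cvector \<Rightarrow> cvector set"
  where "line v \<equiv> cvec.span {v}"

text \<open>Subsets of the projective space are represented by their preimages in \<open>Sym m - {0}\<close>.\<close>

definition zariski_open :: "nat \<Rightarrow> cvector set \<Rightarrow> bool"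
  where "zariski_open m U \<longleftrightarrow> (\<exists>H. (\<forall>h\<in>H. \<exists>d. homogeneous_poly d h) \<and>
    U = {v \<in> Sym m - {0}. \<exists>h\<in>H. h v \<noteq> 0})"

text \<open>Regular sections over \<open>U\<close> of a trivial bundle twisted by \<open>k\<close>: locally quotients of
  homogeneous polynomials with difference of degrees \<open>k\<close>.\<close>

definition regular :: "int \<Rightarrow> cvector set \<Rightarrow> (cvector \<Rightarrow> 'i \<Rightarrow> complex) \<Rightarrow> bool"
  where "regular k U s \<longleftrightarrow> (\<forall>v0\<in>U. \<exists>d e h p.
    homogeneous_poly d h \<and> (\<forall>i. homogeneous_poly e (\<lambda>v. p v i)) \<and> int e - int d = k \<and>
    h v0 \<noteq> 0 \<and> (\<forall>v\<in>U. h v \<noteq> 0 \<longrightarrow> s v = (1 / h v) *\<^sub>C p v))"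

text \<open>The record \<open>(num, den, twist)\<close> represents the bundle whose fibre at the line \<open>L\<close> is
  \<open>num L / den L\<close>, tensored with the power \<open>O(twist)\<close> of the dual of the tautological line bundle.
  An element of the fibre is thus a map \<open>s\<close> from \<open>L - {0}\<close> to \<open>num L / den L\<close> with
  \<open>s (c v) = c^twist s v\<close>, and a section over \<open>U\<close> is a function of \<open>v\<close> in \<open>U\<close> with values in
  \<open>num (line v)\<close>, taken modulo \<open>den (line v)\<close>.\<close>

record 'i vbundle =
  num :: "cvector set \<Rightarrow> ('i \<Rightarrow> complex) set"
  den :: "cvector set \<Rightarrow> ('i \<Rightarrow> complex) set"
  twist :: int

definition subbundle :: "nat \<Rightarrow> (cvector set \<Rightarrow> ('i \<Rightarrow> complex) set) \<Rightarrow> bool"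
  where "subbundle m N \<longleftrightarrow> (\<forall>v0\<in>Sym m - {0}. \<exists>U r s. zariski_open m U \<and> v0 \<in> U \<and>
    (\<forall>i<r. regular 0 U (s i)) \<and>
    (\<forall>v\<in>U. inj_on (\<lambda>i :: nat. s i v) {..<r} \<and> cvec.independent ((\<lambda>i. s i v) ` {..<r}) \<and>
      N (line v) = cvec.span ((\<lambda>i. s i v) ` {..<r})))"

definition vector_bundle :: "nat \<Rightarrow> 'i vbundle \<Rightarrow> bool"
  where "vector_bundle m A \<longleftrightarrow> subbundle m (num A) \<and> subbundle m (den A) \<and>
    (\<forall>v\<in>Sym m - {0}. den A (line v) \<subseteq> num A (line v))"

definition bundle_section :: "nat \<Rightarrow> 'i vbundle \<Rightarrow> cvector set \<Rightarrow> (cvector \<Rightarrow> 'i \<Rightarrow> complex) \<Rightarrow> bool"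
  where "bundle_section m A U s \<longleftrightarrow> (\<forall>v\<in>U. s v \<in> num A (line v)) \<and>
    (\<forall>v0\<in>U. \<exists>U' s'. zariski_open m U' \<and> v0 \<in> U' \<and> U' \<subseteq> U \<and> regular (twist A) U' s' \<and>
      (\<forall>v\<in>U'. s v - s' v \<in> den A (line v)))"

text \<open>A morphism is a family of maps \<open>\<phi> v\<close> inducing linear maps
  \<open>num A (line v) / den A (line v) \<rightarrow> num B (line v) / den B (line v)\<close>, compatible with the
  rescaling of \<open>v\<close>, and taking regular sections to regular sections.\<close>

definition bundle_morphism :: "nat \<Rightarrow> 'i vbundle \<Rightarrow> 'j vbundle
    \<Rightarrow> (cvector \<Rightarrow> ('i \<Rightarrow> complex) \<Rightarrow> 'j \<Rightarrow> complex) \<Rightarrow> bool"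
  where "bundle_morphism m A B \<phi> \<longleftrightarrow>
    (\<forall>v\<in>Sym m - {0}.
      (\<forall>a\<in>num A (line v). \<phi> v a \<in> num B (line v)) \<and>
      (\<forall>a\<in>den A (line v). \<phi> v a \<in> den B (line v)) \<and>
      (\<forall>a\<in>num A (line v). \<forall>a'\<in>num A (line v).
        \<phi> v (a + a') - (\<phi> v a + \<phi> v a') \<in> den B (line v)) \<and>
      (\<forall>c. \<forall>a\<in>num A (line v). \<phi> v (c *\<^sub>C a) - c *\<^sub>C \<phi> v a \<in> den B (line v)) \<and>
      (\<forall>c. c \<noteq> 0 \<longrightarrow> (\<forall>a\<in>num A (line v).
        \<phi> (c *\<^sub>C v) a - (c powi (twist B - twist A)) *\<^sub>C \<phi> v a \<in> den B (line v)))) \<and>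
    (\<forall>U s. zariski_open m U \<longrightarrow> bundle_section m A U s \<longrightarrow>
      bundle_section m B U (\<lambda>v. \<phi> v (s v)))"

text \<open>Exactness of a sequence of vector bundles (equivalently, of their sheaves of sections) is
  exactness on all fibres.\<close>

definition short_exact :: "nat \<Rightarrow> 'i vbundle \<Rightarrow> (cvector \<Rightarrow> ('i \<Rightarrow> complex) \<Rightarrow> 'j \<Rightarrow> complex)
    \<Rightarrow> 'j vbundle \<Rightarrow> (cvector \<Rightarrow> ('j \<Rightarrow> complex) \<Rightarrow> 'k \<Rightarrow> complex) \<Rightarrow> 'k vbundle \<Rightarrow> bool"
  where "short_exact m A \<phi> B \<psi> C \<longleftrightarrow>
    vector_bundle m A \<and> vector_bundle m B \<and> vector_bundle m C \<and>
    bundle_morphism m A B \<phi> \<and> bundle_morphism m B C \<psi> \<and>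
    (\<forall>v\<in>Sym m - {0}.
      (\<forall>a\<in>num A (line v). \<phi> v a \<in> den B (line v) \<longrightarrow> a \<in> den A (line v)) \<and>
      (\<forall>b\<in>num B (line v). \<psi> v b \<in> den C (line v) \<longleftrightarrow>
        (\<exists>a\<in>num A (line v). b - \<phi> v a \<in> den B (line v))) \<and>
      (\<forall>c\<in>num C (line v). \<exists>b\<in>num B (line v). c - \<psi> v b \<in> den C (line v)))"

definition twisted :: "'i vbundle \<Rightarrow> int \<Rightarrow> 'i vbundle"
  where "twisted A k = \<lparr>num = num A, den = den A, twist = twist A + k\<rparr>"

definition trivial_bundle :: "('i \<Rightarrow> complex) set \<Rightarrow> ('i \<Rightarrow> complex) set \<Rightarrow> 'i vbundle"
  where "trivial_bundle M N = \<lparr>num = (\<lambda>_. M), den = (\<lambda>_. N), twist = 0\<rparr>"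

definition kernel_bundle :: "'i vbundle \<Rightarrow> 'j vbundle
    \<Rightarrow> (cvector \<Rightarrow> ('i \<Rightarrow> complex) \<Rightarrow> 'j \<Rightarrow> complex) \<Rightarrow> 'i vbundle"
  where "kernel_bundle A B \<phi> =
    \<lparr>num = (\<lambda>L. {a \<in> num A L. \<forall>v\<in>L - {0}. \<phi> v a \<in> den B L}), den = den A, twist = twist A\<rparr>"

definition cokernel_bundle :: "'i vbundle \<Rightarrow> 'j vbundle
    \<Rightarrow> (cvector \<Rightarrow> ('i \<Rightarrow> complex) \<Rightarrow> 'j \<Rightarrow> complex) \<Rightarrow> 'j vbundle"
  where "cokernel_bundle A B \<phi> =
    \<lparr>num = num B, den = (\<lambda>L. {b + \<phi> v a | b v a. b \<in> den B L \<and> v \<in> L - {0} \<and> a \<in> num A L}),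
     twist = twist B\<rparr>"

section \<open>The tautological, null correlation and Tango bundles\<close>

definition O_minus_one :: "nat vbundle"
  where "O_minus_one = \<lparr>num = (\<lambda>L. L), den = (\<lambda>_. {0}), twist = 0\<rparr>"

definition Q :: "nat \<Rightarrow> nat vbundle"
  where "Q m = cokernel_bundle O_minus_one (trivial_bundle (Sym m) {0}) (\<lambda>v a. a)"

definition O_one :: "unit vbundle"
  where "O_one = twisted (trivial_bundle UNIV {0}) 1"

text \<open>The functional \<open>f(u)\<close> restricted to the line spanned by \<open>v\<close> is determined by its
  value at \<open>v\<close>, a function of \<open>v\<close> of degree one.\<close>

definition N :: "nat \<Rightarrow> cbivector \<Rightarrow> nat vbundle"
  where "N m f = kernel_bundle (Q m) O_one (\<lambda>v u _. bilin m f u v)"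

definition varpi :: "cvector \<Rightarrow> cvector \<Rightarrow> cbivector"
  where "varpi v u = wedge v u"

text \<open>The twist by \<open>- 1\<close> is there because the cokernel is \<open>F(W)(1)\<close>.\<close>

definition F :: "nat \<Rightarrow> cbivector set \<Rightarrow> (nat \<times> nat) vbundle"
  where "F m W = twisted
    (cokernel_bundle (twisted (Q m) (- 1)) (trivial_bundle (Ext2 m) W) varpi) (- 1)"

end

theory Submission
  imports Defs
begin

text \<open>The weight space of weight \<open>k\<close> contains decomposable elements for each of the \<open>4 n + 1\<close>
  weights, and \<open>W\<close> has codimension \<open>4 n + 1\<close>; so \<open>W\<close> is the common kernel of one linear
  form \<open>L k\<close> on each weight space, with all coefficients nonzero. The form of the middle weight
  \<open>m = 2 n + 1\<close> is antidiagonal, hence symplectic and special: this is \<open>f\<close>. As \<open>f\<close> vanishes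
  on \<open>W\<close>, it restricts to the composite of \<open>Q(-1) \<rightarrow> \<Lambda>\<^sup>2V/W\<close> with \<open>\<Lambda>\<^sup>2V/W \<rightarrow> O\<close>,
  whose kernel is \<open>N(f)(-1)\<close>; as it is onto, the kernel of \<open>f\<close> on \<open>\<Lambda>\<^sup>2V/W\<close> still surjects onto
  \<open>F(W)(1)\<close>. That kernel has a basis of weight vectors of the weights \<open>k \<noteq> m\<close>, and so is
  identified with \<open>D/\<complex>f\<close>.\<close>

section \<open>Bivectors in coordinates\<close>

text \<open>\<open>D\<close> cannot be defined as a complement of \<open>W\<close>. By
  \<open>ext_form_f\<close>, the value of the form on \<open>(f, f)\<close> is \<open>L m f\<close>,
  a sum of squares of the numbers \<open>c (p, q) / (fact p * fact q)\<close> over the pairs of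
  weight \<open>m\<close>; over the complex numbers it can vanish, and then \<open>f\<close> lies in
  \<open>W\<close>. So \<open>D\<close> is spanned by \<open>f\<close> and one basis bivector, its
  lead, for each weight \<open>k \<noteq> m\<close>, while a true complement of \<open>W\<close> is
  spanned by all the leads, the one of weight \<open>m\<close> included. The two spaces are matched
  by their entries at the leads: \<open>f\<close> has a nonzero entry at \<open>lead m m\<close> and
  at no other lead, and the normalisation \<open>c (lead m k) = 1\<close> makes \<open>L k\<close>
  agree with the entry at \<open>lead m k\<close> on combinations of leads. Exactness then becomes a
  comparison of the numbers \<open>L k\<close>. The absence of decomposables is needed again in the
  bundle part, for injectivity on fibres and for the constant rank behind the Tango bundle.\<close>

lemma sum_fun_apply: "(\<Sum>i\<in>A. f i) x = (\<Sum>i\<in>A. f i x)"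
  for f :: "'a \<Rightarrow> 'b \<Rightarrow> complex"
  by (induction A rule: infinite_finite_induct) auto

lemma cscale_apply: "(c *\<^sub>C u) i = c * u i"
  by (simp add: cscale_def)

abbreviation basis_wedge :: "nat \<times> nat \<Rightarrow> cbivector"
  where "basis_wedge y \<equiv> wedge (monom_vec (fst y)) (monom_vec (snd y))"

definition pairs :: "nat \<Rightarrow> (nat \<times> nat) set"
  where "pairs m = {(p, q). p < q \<and> q \<le> m}"

definition wpairs :: "nat \<Rightarrow> nat \<Rightarrow> (nat \<times> nat) set"
  where "wpairs m k = {(p, q). p < q \<and> q \<le> m \<and> p + q = k}"

text \<open>Written as a vanishing sum so that closure under linear combinations is plain
  distributivity; at \<open>p = q\<close> it forces a zero diagonal.\<close>

definition antisym_array :: "cbivector \<Rightarrow> bool"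
  where "antisym_array x \<longleftrightarrow> (\<forall>p q. x (p, q) + x (q, p) = 0)"

lemma antisym_arrayD: "antisym_array x \<Longrightarrow> x (q, p) = - x (p, q)"
  using antisym_array_def[of x] by (simp add: eq_neg_iff_add_eq_0)

lemma finite_pairs [simp]: "finite (pairs m)"
  by (rule finite_subset[of _ "{..m} \<times> {..m}"]) (auto simp: pairs_def)

lemma finite_wpairs [simp]: "finite (wpairs m k)"
  by (rule finite_subset[OF _ finite_pairs[of m]]) (auto simp: pairs_def wpairs_def)

lemma wpairs_subset_pairs: "wpairs m k \<subseteq> pairs m"
  by (auto simp: pairs_def wpairs_def)

lemma basis_wedge_apply:
  "basis_wedge y (i, j) = (if y = (i, j) then 1 else 0) - (if y = (j, i) then 1 else 0)"
  by (cases y; cases "i = fst y"; cases "j = snd y"; cases "j = fst y"; cases "i = snd y")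
    (simp_all add: wedge_def monom_vec_def)

text \<open>Antisymmetry supplies the entries below the diagonal. Leaving \<open>S\<close> free lets
  one expansion serve the whole exterior square and each single weight.\<close>

lemma antisym_array_expand:
  assumes "S \<subseteq> pairs m" "antisym_array x"
    and supp: "\<And>p q. p < q \<Longrightarrow> x (p, q) \<noteq> 0 \<Longrightarrow> (p, q) \<in> S"
  shows "x = (\<Sum>y\<in>S. x y *\<^sub>C basis_wedge y)"
proof
  have fin: "finite S"
    by (rule finite_subset[OF assms(1) finite_pairs])
  have S: "S \<subseteq> {(p, q). p < q}"
    using assms(1) by (auto simp: pairs_def)
  fix z :: "nat \<times> nat"
  obtain i j where z: "z = (i, j)" by (cases z)
  have anti: "x (j, i) = - x (i, j)"
    by (rule antisym_arrayD[OF assms(2)])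
  have "(\<Sum>y\<in>S. x y *\<^sub>C basis_wedge y) z =
      (\<Sum>y\<in>S. if y = (i, j) then x y else 0) - (\<Sum>y\<in>S. if y = (j, i) then x y else 0)"
    unfolding z sum_fun_apply sum_subtractf[symmetric]
    by (intro sum.cong refl) (simp only: cscale_apply basis_wedge_apply right_diff_distrib
        if_distrib[of "\<lambda>a. _ * a"] mult_1_right mult_zero_right)
  also have "\<dots> = (if (i, j) \<in> S then x (i, j) else 0) - (if (j, i) \<in> S then x (j, i) else 0)"
    using fin by simp
  also have "\<dots> = x (i, j)"
    using S anti supp[of i j] supp[of j i] by (cases i j rule: linorder_cases) auto
  finally show "x z = (\<Sum>y\<in>S. x y *\<^sub>C basis_wedge y) z"
    by (simp add: z)
qed

lemma subspace_antisym_supported: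
  "cvec.subspace {x. antisym_array x \<and> (\<forall>p q. P p q \<longrightarrow> x (p, q) = 0)}"
  by (auto simp: cvec.subspace_def antisym_array_def cscale_apply algebra_simps simp flip: distrib_left)

lemma antisym_array_wedge: "antisym_array (wedge u v)"
  by (auto simp: antisym_array_def wedge_def)

lemma monom_vec_in_Sym: "j \<le> m \<Longrightarrow> monom_vec j \<in> Sym m"
  by (auto simp: Sym_def monom_vec_def)

lemma basis_wedge_in_Ext2: "y \<in> pairs m \<Longrightarrow> basis_wedge y \<in> Ext2 m"
  unfolding Ext2_def by (rule cvec.span_base) (fastforce simp: pairs_def intro: monom_vec_in_Sym)

lemma basis_wedge_in_E: "y \<in> wpairs m k \<Longrightarrow> basis_wedge y \<in> E m k"
  unfolding E_def by (rule cvec.span_base) (fastforce simp: wpairs_def)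

text \<open>Trades the span for conditions on entries. Bounding the first index suffices, as
  antisymmetry carries the bound to the second.\<close>

lemma Ext2_eq: "Ext2 m = {x. antisym_array x \<and> (\<forall>p q. p > m \<longrightarrow> x (p, q) = 0)}"
proof
  show "Ext2 m \<subseteq> {x. antisym_array x \<and> (\<forall>p q. p > m \<longrightarrow> x (p, q) = 0)}"
    unfolding Ext2_def
  proof (rule cvec.span_minimal)
    show "{wedge u v |u v. u \<in> Sym m \<and> v \<in> Sym m} \<subseteq>
        {x. antisym_array x \<and> (\<forall>p q. p > m \<longrightarrow> x (p, q) = 0)}"
      using antisym_array_wedge by (fastforce simp: Sym_def wedge_def)
  qed (rule subspace_antisym_supported)
next
  show "{x. antisym_array x \<and> (\<forall>p q. p > m \<longrightarrow> x (p, q) = 0)} \<subseteq> Ext2 m"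
  proof
    fix x assume x: "x \<in> {x. antisym_array x \<and> (\<forall>p q. p > m \<longrightarrow> x (p, q) = 0)}"
    then have "x (q, p) = - x (p, q)" for p q
      by (intro antisym_arrayD) simp
    with x have "x (q, p) = 0" if "p > m" for p q
      using that by (metis (mono_tags, lifting) mem_Collect_eq neg_0_equal_iff_equal)
    then have "x = (\<Sum>y\<in>pairs m. x y *\<^sub>C basis_wedge y)"
      using x by (intro antisym_array_expand[OF subset_refl]) (auto simp: pairs_def not_less[symmetric])
    also have "\<dots> \<in> cvec.span (Ext2 m)"
      by (intro cvec.span_sum cvec.span_scale cvec.span_base basis_wedge_in_Ext2)
    finally show "x \<in> Ext2 m"
      by (simp add: Ext2_def cvec.span_span)
  qed
qed

lemma subspace_Ext2: "cvec.subspace (Ext2 m)"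
  by (simp add: Ext2_def)

lemma wedge_in_Ext2: "u \<in> Sym m \<Longrightarrow> v \<in> Sym m \<Longrightarrow> wedge u v \<in> Ext2 m"
  unfolding Ext2_def by (rule cvec.span_base) auto

lemma Ext2_antisym: "x \<in> Ext2 m \<Longrightarrow> x (q, p) = - x (p, q)"
  by (rule antisym_arrayD) (simp add: Ext2_eq)

lemma Ext2_supp: "x \<in> Ext2 m \<Longrightarrow> p > m \<or> q > m \<Longrightarrow> x (p, q) = 0"
  using Ext2_antisym[of x m p q] unfolding Ext2_eq by auto

lemma Ext2_subset_span: "Ext2 m \<subseteq> cvec.span (basis_wedge ` pairs m)"
proof
  fix x assume x: "x \<in> Ext2 m"
  have "x = (\<Sum>y\<in>pairs m. x y *\<^sub>C basis_wedge y)"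
    using x Ext2_supp[OF x]
    by (intro antisym_array_expand[OF subset_refl]) (auto simp: Ext2_eq pairs_def not_less[symmetric])
  also have "\<dots> \<in> cvec.span (basis_wedge ` pairs m)"
    by (intro cvec.span_sum cvec.span_scale cvec.span_base) auto
  finally show "x \<in> cvec.span (basis_wedge ` pairs m)" .
qed

lemma E_eq: "E m k = {x \<in> Ext2 m. \<forall>p q. p + q \<noteq> k \<longrightarrow> x (p, q) = 0}"
proof
  have "E m k \<subseteq> {x. antisym_array x \<and> (\<forall>p q. p > m \<or> p + q \<noteq> k \<longrightarrow> x (p, q) = 0)}"
    unfolding E_def
  proof (rule cvec.span_minimal)
    show "{wedge (monom_vec p) (monom_vec q) |p q. p < q \<and> q \<le> m \<and> p + q = k} \<subseteq>
        {x. antisym_array x \<and> (\<forall>p q. p > m \<or> p + q \<noteq> k \<longrightarrow> x (p, q) = 0)}"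
      using antisym_array_wedge by (fastforce simp: wedge_def monom_vec_def)
  qed (rule subspace_antisym_supported)
  then show "E m k \<subseteq> {x \<in> Ext2 m. \<forall>p q. p + q \<noteq> k \<longrightarrow> x (p, q) = 0}"
    unfolding Ext2_eq by blast
next
  show "{x \<in> Ext2 m. \<forall>p q. p + q \<noteq> k \<longrightarrow> x (p, q) = 0} \<subseteq> E m k"
  proof
    fix x assume x: "x \<in> {x \<in> Ext2 m. \<forall>p q. p + q \<noteq> k \<longrightarrow> x (p, q) = 0}"
    then have "x (p, q) = 0" if "q > m \<or> p + q \<noteq> k" for p q
      using Ext2_supp[of x m p q] that by auto
    then have "x = (\<Sum>y\<in>wpairs m k. x y *\<^sub>C basis_wedge y)"
      using x by (intro antisym_array_expand[OF wpairs_subset_pairs]) (auto simp: wpairs_def Ext2_eq not_less[symmetric])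
    also have "\<dots> \<in> cvec.span (E m k)"
      by (intro cvec.span_sum cvec.span_scale cvec.span_base basis_wedge_in_E)
    finally show "x \<in> E m k"
      by (simp add: E_def cvec.span_span)
  qed
qed

lemma subspace_E: "cvec.subspace (E m k)"
  by (simp add: E_def)

lemma E_subset_Ext2: "E m k \<subseteq> Ext2 m"
  by (auto simp: E_eq)

section \<open>Dimension of the exterior square and vanishing of decomposable bivectors\<close>

lemma card_pairs: "card (pairs m) = Suc m choose 2"
proof -
  have "bij_betw (\<lambda>(p, q). {p, q}) (pairs m) {T. T \<subseteq> {..m} \<and> card T = 2}"
    unfolding bij_betw_def
  proof
    show "inj_on (\<lambda>(p, q). {p, q}) (pairs m)"
      by (auto simp: inj_on_def pairs_def doubleton_eq_iff)
    show "(\<lambda>(p, q). {p, q}) ` pairs m = {T. T \<subseteq> {..m} \<and> card T = 2}"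
    proof (intro equalityI subsetI)
      fix T assume "T \<in> {T. T \<subseteq> {..m} \<and> card T = 2}"
      then obtain a b where T: "T = {a, b}" "a \<noteq> b" "a \<le> m" "b \<le> m"
        by (auto simp: card_2_iff)
      then have "T = {min a b, max a b}" "min a b < max a b" "max a b \<le> m"
        by (auto simp: min_def max_def)
      then show "T \<in> (\<lambda>(p, q). {p, q}) ` pairs m"
        by (auto simp: pairs_def intro!: image_eqI[of _ _ "(min a b, max a b)"])
    qed (auto simp: pairs_def)
  qed
  then have "card (pairs m) = card {T. T \<subseteq> {..m} \<and> card T = 2}"
    by (rule bij_betw_same_card)
  then show ?thesis
    by (simp add: n_subsets)
qed

text \<open>Turns the absence of decomposables in \<open>W\<close> into a statement about lines: if
  \<open>wedge v a\<close> is in \<open>W\<close>, then \<open>a\<close> is in the line of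
  \<open>v\<close>.\<close>

lemma wedge_eq_0_imp_in_line:
  assumes "wedge v a = 0" "v \<noteq> 0"
  shows "a \<in> line v"
proof -
  obtain j where j: "v j \<noteq> 0"
    using assms(2) by (auto simp: fun_eq_iff)
  have "v j * a i = a j * v i" for i
    using fun_cong[OF assms(1), of "(j, i)"] by (simp add: wedge_def algebra_simps)
  then have "a = (a j / v j) *\<^sub>C v"
    using j by (auto simp: fun_eq_iff cscale_apply field_simps)
  then show ?thesis
    by (metis cvec.span_base cvec.span_scale singletonI)
qed

lemma line_eq: "cvec.span {v} = {c *\<^sub>C v | c. True}"
  by (auto simp: cvec.span_singleton)

lemma wedge_add_right: "wedge v (a + b) = wedge v a + wedge v b"
  by (auto simp: wedge_def fun_eq_iff algebra_simps)

lemma wedge_scale_right: "wedge v (c *\<^sub>C a) = c *\<^sub>C wedge v a"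
  by (auto simp: wedge_def fun_eq_iff cscale_apply algebra_simps)

lemma wedge_scale_left: "wedge (c *\<^sub>C v) a = c *\<^sub>C wedge v a"
  by (auto simp: wedge_def fun_eq_iff cscale_apply algebra_simps)

lemma subspace_Sym: "cvec.subspace (Sym m)"
  by (auto simp: cvec.subspace_def Sym_def cscale_apply)

section \<open>Torus-invariant subspaces without decomposable elements\<close>

definition weight_part :: "nat \<Rightarrow> cbivector \<Rightarrow> cbivector"
  where "weight_part k x = (\<lambda>(p, q). if p + q = k then x (p, q) else 0)"

text \<open>The linear form on the weight space with coefficients \<open>c\<close>, extended by zero
  to the other weights.\<close>

definition weight_form :: "nat \<Rightarrow> cbivector \<Rightarrow> nat \<Rightarrow> cbivector \<Rightarrow> complex"
  where "weight_form m c k x = (\<Sum>y\<in>wpairs m k. c y * x y)"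

text \<open>Truncated subtraction makes this \<open>(0, k)\<close> for \<open>k \<le> m\<close> and \<open>(k - m, m)\<close> otherwise.\<close>

definition lead :: "nat \<Rightarrow> nat \<Rightarrow> nat \<times> nat"
  where "lead m k = (k - m, min k m)"

lemma lead_in_wpairs: "k \<in> {1..2 * m - 1} \<Longrightarrow> lead m k \<in> wpairs m k"
  by (auto simp: lead_def wpairs_def)

lemma weight_part_add: "weight_part k (x + y) = weight_part k x + weight_part k y"
  by (auto simp: weight_part_def fun_eq_iff)

lemma weight_part_scale: "weight_part k (c *\<^sub>C x) = c *\<^sub>C weight_part k x"
  by (auto simp: weight_part_def fun_eq_iff cscale_apply)

lemma weight_part_zero: "weight_part k 0 = 0"
  by (auto simp: weight_part_def fun_eq_iff)

lemma weight_part_E: "x \<in> E m j \<Longrightarrow> weight_part k x = (if j = k then x else 0)"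
  by (auto simp: weight_part_def fun_eq_iff E_eq)

lemma weight_part_expand:
  assumes "x \<in> Ext2 m"
  shows "weight_part k x = (\<Sum>y\<in>wpairs m k. x y *\<^sub>C basis_wedge y)"
proof -
  have "weight_part k x = (\<Sum>y\<in>wpairs m k. weight_part k x y *\<^sub>C basis_wedge y)"
  proof (rule antisym_array_expand[OF wpairs_subset_pairs])
    show "antisym_array (weight_part k x)"
      using assms by (auto simp: Ext2_eq antisym_array_def weight_part_def add.commute)
    show "(p, q) \<in> wpairs m k" if "p < q" "weight_part k x (p, q) \<noteq> 0" for p q
      using that Ext2_supp[OF assms, of p q]
      by (auto simp: wpairs_def weight_part_def not_less[symmetric] split: if_splits)
  qed
  also have "\<dots> = (\<Sum>y\<in>wpairs m k. x y *\<^sub>C basis_wedge y)"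
    by (intro sum.cong refl) (auto simp: wpairs_def weight_part_def)
  finally show ?thesis .
qed

lemma sum_weight_parts:
  assumes "x \<in> Ext2 m"
  shows "(\<Sum>k\<in>{1..2 * m - 1}. weight_part k x) = x"
proof
  fix z :: "nat \<times> nat"
  obtain i j where z: "z = (i, j)" by (cases z)
  \<comment> \<open>Off the diagonal, a weight outside this range forces an index beyond
    \<open>m\<close>; on the diagonal antisymmetry gives zero.\<close>
  have *: "x (i, j) = 0" if "i + j \<notin> {1..2 * m - 1}"
  proof (cases "i = j")
    case True
    then show ?thesis using Ext2_antisym[OF assms, of i j] by simp
  next
    case False
    then have "i > m \<or> j > m" using that by auto
    then show ?thesis using Ext2_supp[OF assms] by blast
  qed
  have "(\<Sum>k\<in>{1..2 * m - 1}. weight_part k x) z = (\<Sum>k\<in>{1..2 * m - 1}. if k = i + j then x (i, j) else 0)"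
    unfolding z sum_fun_apply by (intro sum.cong refl) (auto simp: weight_part_def)
  also have "\<dots> = x z"
    using * by (simp only: sum.delta finite_atLeastAtMost z split: if_splits) simp
  finally show "(\<Sum>k\<in>{1..2 * m - 1}. weight_part k x) z = x z" .
qed

text \<open>\<open>W\<close> is spanned by weight vectors, and the projection fixes or kills each of
  them.\<close>

lemma torus_invariant_weight_part:
  assumes "torus_invariant m W" "x \<in> W"
  shows "weight_part k x \<in> W"
proof -
  have W: "cvec.subspace W" "W = cvec.span (\<Union>k\<in>{1..2 * m - 1}. W \<inter> E m k)"
    using assms(1) by (auto simp: torus_invariant_def)
  have "x \<in> cvec.span (\<Union>k\<in>{1..2 * m - 1}. W \<inter> E m k)"
    using assms(2) W(2) by simp
  then show ?thesis
  proof (induction rule: cvec.span_induct)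
    case base
    then show ?case
      using W(1) by (auto simp: cvec.subspace_def weight_part_add weight_part_scale weight_part_zero)
  next
    case (step x)
    then show ?case
      using cvec.subspace_0[OF W(1)] by (auto simp: weight_part_E)
  qed
qed

text \<open>Basis bivectors are decomposable, hence outside \<open>W\<close>, so \<open>W\<close>
  misses at least one dimension in each weight. Its codimension equals the number of weights, so it
  misses exactly one. \<open>c y\<close> is the coordinate of \<open>basis_wedge y\<close> modulo
  \<open>W\<close> along the lead of its weight, and is nonzero because \<open>basis_wedge y\<close>
  is not in \<open>W\<close>.\<close>

lemma tango_subspace_hyperplanes:
  assumes "n > 0" and W: "W \<in> tango_subspaces n"
  defines "m \<equiv> 2 * n + 1"
  shows "\<exists>c. (\<forall>y\<in>pairs m. c y \<noteq> 0) \<and> (\<forall>k\<in>{1..2 * m - 1}. c (lead m k) = 1) \<and>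
    W = {x \<in> Ext2 m. \<forall>k\<in>{1..2 * m - 1}. weight_form m c k x = 0}"
proof -
  define K where "K = {1..2 * m - 1}"
  define b where "b k = basis_wedge (lead m k)" for k
  have inv: "torus_invariant m W"
    and dimW: "cvec.dim W = ((2 * n + 2) choose 2) - 4 * n - 1"
    and nodec: "\<And>u v. u \<in> Sym m \<Longrightarrow> v \<in> Sym m \<Longrightarrow> wedge u v \<noteq> 0 \<Longrightarrow> wedge u v \<notin> W"
    using W by (auto simp: tango_subspaces_def m_def)
  then have subW: "cvec.subspace W" and WE: "W \<subseteq> Ext2 m"
    by (auto simp: torus_invariant_def)
  have not_W: "basis_wedge y \<notin> W" if "y \<in> pairs m" for y
  proof (rule nodec)
    have "basis_wedge y y \<noteq> 0"
      using that basis_wedge_apply[of y "fst y" "snd y"] by (auto simp: pairs_def)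
    then show "basis_wedge y \<noteq> 0"
      by (metis zero_fun_apply)
  qed (use that in \<open>auto simp: pairs_def intro!: monom_vec_in_Sym\<close>)
  have scale_not_W: "a = 0" if "a *\<^sub>C basis_wedge y \<in> W" "y \<in> pairs m" for a y
  proof (rule ccontr)
    assume "a \<noteq> 0"
    then have "basis_wedge y = (1 / a) *\<^sub>C (a *\<^sub>C basis_wedge y)"
      by (simp add: cscale_def)
    then show False
      using cvec.subspace_scale[OF subW that(1), of "1 / a"] not_W[OF that(2)] by metis
  qed
  have lead: "lead m k \<in> wpairs m k" "lead m k \<in> pairs m" if "k \<in> K" for k
    using lead_in_wpairs[of k m] wpairs_subset_pairs that unfolding K_def by blast+
  have bE: "b k \<in> E m k" if "k \<in> K" for k
    using basis_wedge_in_E lead that unfolding b_def by blast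

  obtain B where B: "B \<subseteq> W" "cvec.independent B" "W \<subseteq> cvec.span B" "card B = cvec.dim W"
    using cvec.basis_exists by blast
  have spanB: "cvec.span B = W"
    using B subW by (simp add: cvec.span_minimal subset_antisym)
  have bound: "finite T \<and> card T \<le> Suc m choose 2" if "cvec.independent T" "T \<subseteq> Ext2 m" for T
  proof -
    have "finite T \<and> card T \<le> card (basis_wedge ` pairs m)"
      using that Ext2_subset_span by (intro cvec.independent_span_bound) auto
    moreover have "card (basis_wedge ` pairs m) \<le> Suc m choose 2"
      using card_image_le[of "pairs m" basis_wedge] by (simp add: card_pairs)
    ultimately show ?thesis by simp
  qed
  have finB: "finite B"
    using bound B WE by blast
  \<comment> \<open>The leads are independent modulo \<open>W\<close>: a relation expressing
    \<open>b k\<close> through \<open>W\<close> and leads of other weights, projected to weight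
    \<open>k\<close>, would put \<open>b k\<close> in \<open>W\<close>.\<close>
  have step: "cvec.independent (B \<union> b ` J) \<and> card (B \<union> b ` J) = card B + card J"
    if "J \<subseteq> K" "finite J" for J
    using that(2,1)
  proof (induction J rule: finite_induct)
    case empty
    then show ?case using B by simp
  next
    case (insert k J)
    have "b k \<notin> cvec.span (B \<union> b ` J)"
    proof
      assume "b k \<in> cvec.span (B \<union> b ` J)"
      then obtain w y where wy: "b k = w + y" "w \<in> W" "y \<in> cvec.span (b ` J)"
        unfolding cvec.span_Un spanB by auto
      have "weight_part k y = 0"
        using wy(3)
      proof (induction rule: cvec.span_induct)
        case base
        then show ?case
          unfolding cvec.subspace_def mem_Collect_eq weight_part_add weight_part_scale
            weight_part_zero by simp
      next
        case (step x)
        then obtain j where "j \<in> J" "x = b j" by blast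
        moreover from this have "j \<in> K" "j \<noteq> k"
          using insert.hyps insert.prems by auto
        ultimately show ?case
          using weight_part_E[OF bE[of j]] by simp
      qed
      then have "b k = weight_part k w"
        using arg_cong[OF wy(1), of "weight_part k"] weight_part_E[OF bE, of k k] insert.prems
        by (simp add: weight_part_add)
      then show False
        using torus_invariant_weight_part[OF inv wy(2), of k] not_W[OF lead(2), of k] insert.prems
        unfolding b_def by (metis insert_subset)
    qed
    moreover from this have "b k \<notin> B \<union> b ` J"
      using cvec.span_base by metis
    ultimately have "cvec.independent (insert (b k) (B \<union> b ` J))"
        "card (insert (b k) (B \<union> b ` J)) = card B + Suc (card J)"
      using insert finB by (simp_all add: cvec.independent_insertI)
    then show ?case
      using insert.hyps by simp
  qed
  define T where "T = B \<union> b ` K"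
  have T: "cvec.independent T" "card T = card B + card K"
    using step[of K] unfolding T_def K_def by auto
  have TE: "T \<subseteq> Ext2 m"
    using B(1) WE bE E_subset_Ext2 unfolding T_def by blast
  \<comment> \<open>Guards the truncated subtraction in the dimension of \<open>W\<close>, so that
    \<open>card B\<close> and the \<open>4 * n + 1\<close> leads add up to the full
    dimension.\<close>
  have "4 * n + 1 \<le> (2 * n + 2) choose 2"
    using \<open>n > 0\<close> by (cases n) (auto simp: choose_two)
  then have cardT: "card T = Suc m choose 2"
    unfolding T(2) B(4) dimW K_def m_def by simp
  \<comment> \<open>\<open>T\<close> is independent of maximal size; a vector outside its span would
    enlarge it past the bound.\<close>
  have spanT: "x \<in> cvec.span T" if x: "x \<in> Ext2 m" for x
  proof (rule ccontr)
    assume nx: "x \<notin> cvec.span T"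
    then have "cvec.independent (insert x T)"
      using T(1) by (rule cvec.independent_insertI)
    then have "card (insert x T) \<le> Suc m choose 2"
      using bound[of "insert x T"] x TE by simp
    moreover have "x \<notin> T" "finite T"
      using nx cvec.span_base[of x T] bound[OF T(1) TE] by auto
    ultimately show False
      using cardT by simp
  qed

  \<comment> \<open>Decompose along \<open>W\<close> and the leads, then project to the weight of
    \<open>y\<close>: only the lead of that weight survives.\<close>
  have "\<exists>a. basis_wedge y - a *\<^sub>C b (fst y + snd y) \<in> W" if y: "y \<in> pairs m" for y
  proof -
    define k where "k = fst y + snd y"
    have k: "y \<in> wpairs m k" "k \<in> K"
      using y by (auto simp: k_def pairs_def wpairs_def K_def)
    have "basis_wedge y \<in> cvec.span (B \<union> b ` K)"
      using spanT[OF basis_wedge_in_Ext2[OF y]] by (simp add: T_def)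
    then obtain w z where wz: "basis_wedge y = w + z" "w \<in> W" "z \<in> cvec.span (b ` K)"
      unfolding cvec.span_Un spanB by auto
    have "weight_part k z \<in> cvec.span {b k}"
      using wz(3)
    proof (induction rule: cvec.span_induct)
      case base
      show ?case
        unfolding cvec.subspace_def mem_Collect_eq weight_part_add weight_part_scale weight_part_zero
        by (simp add: cvec.span_zero cvec.span_add cvec.span_scale)
    next
      case (step x)
      then obtain j where "j \<in> K" "x = b j" by blast
      then show ?case
        using weight_part_E[OF bE[of j]] by (simp add: cvec.span_zero cvec.span_base)
    qed
    then obtain a where "weight_part k z = a *\<^sub>C b k"
      unfolding line_eq by blast
    then have "basis_wedge y = weight_part k w + a *\<^sub>C b k"
      using arg_cong[OF wz(1), of "weight_part k"] weight_part_E[OF basis_wedge_in_E[OF k(1)], of k]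
      by (simp add: weight_part_add)
    then have "basis_wedge y - a *\<^sub>C b k \<in> W"
      using torus_invariant_weight_part[OF inv wz(2), of k] by simp
    then show ?thesis unfolding k_def by blast
  qed
  then obtain c where c: "\<And>y. y \<in> pairs m \<Longrightarrow> basis_wedge y - c y *\<^sub>C b (fst y + snd y) \<in> W"
    by metis
  have diff: "weight_part k x - weight_form m c k x *\<^sub>C b k \<in> W" if x: "x \<in> Ext2 m" for k x
  proof -
    have "weight_part k x - weight_form m c k x *\<^sub>C b k =
        (\<Sum>y\<in>wpairs m k. x y *\<^sub>C (basis_wedge y - c y *\<^sub>C b (fst y + snd y)))"
      unfolding weight_part_expand[OF x] weight_form_def cvec.scale_sum_left sum_subtractf[symmetric]
      by (intro sum.cong refl)
        (auto simp: wpairs_def fun_eq_iff cscale_apply algebra_simps)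
    also have "\<dots> \<in> W"
      using wpairs_subset_pairs
      by (intro cvec.subspace_sum[OF subW] cvec.subspace_scale[OF subW] c) blast
    finally show ?thesis .
  qed
  show ?thesis
  proof (intro exI conjI ballI)
    show "c y \<noteq> 0" if "y \<in> pairs m" for y
      using c[OF that] not_W[OF that] by auto
    \<comment> \<open>The normalisation is automatic: this is the coordinate of the lead along
      itself, and no nonzero multiple of the lead is in \<open>W\<close>.\<close>
    show "c (lead m k) = 1" if "k \<in> {1..2 * m - 1}" for k
    proof -
      have k: "k \<in> K" using that by (simp add: K_def)
      have "fst (lead m k) + snd (lead m k) = k"
        using lead(1)[OF k] by (auto simp: wpairs_def)
      then have "basis_wedge (lead m k) - c (lead m k) *\<^sub>C b k \<in> W"
        using c[OF lead(2)[OF k]] by simp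
      also have "basis_wedge (lead m k) - c (lead m k) *\<^sub>C b k = (1 - c (lead m k)) *\<^sub>C basis_wedge (lead m k)"
        by (simp add: b_def fun_eq_iff cscale_apply algebra_simps)
      finally show ?thesis
        using scale_not_W lead(2)[OF k] by fastforce
    qed
    show "W = {x \<in> Ext2 m. \<forall>k\<in>{1..2 * m - 1}. weight_form m c k x = 0}"
    proof (intro equalityI subsetI)
      fix x assume x: "x \<in> W"
      have "weight_form m c k x = 0" if "k \<in> K" for k
      proof -
        have "weight_part k x - (weight_part k x - weight_form m c k x *\<^sub>C b k) \<in> W"
          using x WE by (intro cvec.subspace_diff[OF subW torus_invariant_weight_part[OF inv] diff]) auto
        then show ?thesis
          using scale_not_W lead(2)[OF that] by (simp add: b_def)
      qed
      then show "x \<in> {x \<in> Ext2 m. \<forall>k\<in>{1..2 * m - 1}. weight_form m c k x = 0}"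
        using x WE by (auto simp: K_def)
    next
      fix x assume x: "x \<in> {x \<in> Ext2 m. \<forall>k\<in>{1..2 * m - 1}. weight_form m c k x = 0}"
      have "weight_part k x \<in> W" if "k \<in> {1..2 * m - 1}" for k
      proof -
        have "weight_form m c k x = 0" "x \<in> Ext2 m" using x that by blast+
        then show ?thesis using diff[of x k] by simp
      qed
      then have "(\<Sum>k\<in>{1..2 * m - 1}. weight_part k x) \<in> W"
        by (rule cvec.subspace_sum[OF subW])
      then show "x \<in> W"
        using x by (simp only: sum_weight_parts mem_Collect_eq)
    qed
  qed
qed

section \<open>Regular sections, subbundles and morphisms\<close>

lemma homogeneous_poly_scale: "homogeneous_poly d p \<Longrightarrow> homogeneous_poly d (\<lambda>v. c * p v)"
  using hp_mult[OF hp_const[of c]] by simp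

text \<open>Zero has every degree, as a product with coordinates; empty sums need this.\<close>

lemma homogeneous_poly_zero: "homogeneous_poly d (\<lambda>_. 0)"
proof (induction d)
  case 0
  show ?case by (rule hp_const)
next
  case (Suc d)
  from hp_mult[OF hp_coord[of 0] Suc] show ?case by simp
qed

lemma homogeneous_poly_sum:
  "(\<And>i. i \<in> A \<Longrightarrow> homogeneous_poly d (p i)) \<Longrightarrow> homogeneous_poly d (\<lambda>v. \<Sum>i\<in>A. p i v)"
  by (induction A rule: infinite_finite_induct) (auto intro: homogeneous_poly_zero hp_add)

lemma homogeneous_poly_diff:
  assumes "homogeneous_poly d p" "homogeneous_poly d q"
  shows "homogeneous_poly d (\<lambda>v. p v - q v)"
  using hp_add[OF assms(1) homogeneous_poly_scale[OF assms(2), of "- 1"]] by simp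

lemma homogeneous_poly_wedge:
  assumes "\<And>i. homogeneous_poly d (\<lambda>v. p v i)" "\<And>i. homogeneous_poly e (\<lambda>v. q v i)"
  shows "homogeneous_poly (d + e) (\<lambda>v. wedge (p v) (q v) y)"
  unfolding wedge_def split_def
  by (intro homogeneous_poly_diff hp_mult assms)

lemma zariski_open_full: "zariski_open m (Sym m - {0})"
  unfolding zariski_open_def
  by (rule exI[of _ "{\<lambda>_. 1}"]) (auto intro: hp_const)

lemma zariski_open_coord: "zariski_open m {v \<in> Sym m - {0}. v j \<noteq> 0}"
  unfolding zariski_open_def
  by (rule exI[of _ "{\<lambda>v. v j}"]) (auto intro: hp_coord)

lemma regular_const: "regular 0 U (\<lambda>_. b)"
  unfolding regular_def
proof (intro ballI exI conjI allI impI)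
  show "homogeneous_poly 0 (\<lambda>_. 1 :: complex)" "homogeneous_poly 0 (\<lambda>_. b i)" for i
    by (rule hp_const)+
qed (auto simp: cscale_def)

lemma regular_divide_coord:
  assumes "\<And>i. homogeneous_poly 1 (\<lambda>v. p v i)"
  shows "regular 0 {v \<in> Sym m - {0}. v j \<noteq> 0} (\<lambda>v. (1 / v j) *\<^sub>C p v)"
  unfolding regular_def
proof (intro ballI exI conjI allI impI)
  show "homogeneous_poly 1 (\<lambda>v. v j)" "homogeneous_poly 1 (\<lambda>v. p v i)" for i
    by (rule hp_coord assms)+
qed auto

section \<open>Local frames\<close>

lemma sum_cscale_reindex:
  assumes "inj_on s {..<r}"
  shows "(\<Sum>w\<in>s ` {..<r :: nat}. u w *\<^sub>C w) = (\<Sum>i<r. u (s i) *\<^sub>C s i)"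
  by (simp add: sum.reindex[OF assms])

text \<open>A family over any finite index set, with independence stated through coefficients:
  explicit frames, for instance over a disjoint sum, are checked without numbering them or proving
  their values distinct.\<close>

definition local_frame :: "nat \<Rightarrow> (cvector set \<Rightarrow> ('i \<Rightarrow> complex) set) \<Rightarrow> cvector set
    \<Rightarrow> 'j set \<Rightarrow> ('j \<Rightarrow> cvector \<Rightarrow> 'i \<Rightarrow> complex) \<Rightarrow> bool"
  where "local_frame m M U J s \<longleftrightarrow> zariski_open m U \<and> finite J \<and> (\<forall>j\<in>J. regular 0 U (s j)) \<and>
    (\<forall>v\<in>U. (\<forall>g. (\<Sum>j\<in>J. g j *\<^sub>C s j v) = 0 \<longrightarrow> (\<forall>j\<in>J. g j = 0)) \<and>
      M (line v) = {\<Sum>j\<in>J. g j *\<^sub>C s j v | g. True})"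

lemma local_frameI:
  assumes "zariski_open m U" "finite J" "\<And>j. j \<in> J \<Longrightarrow> regular 0 U (s j)"
    and "\<And>v g j. v \<in> U \<Longrightarrow> (\<Sum>j\<in>J. g j *\<^sub>C s j v) = 0 \<Longrightarrow> j \<in> J \<Longrightarrow> g j = 0"
    and "\<And>v x. v \<in> U \<Longrightarrow> x \<in> M (line v) \<Longrightarrow> \<exists>g. x = (\<Sum>j\<in>J. g j *\<^sub>C s j v)"
    and "\<And>v g. v \<in> U \<Longrightarrow> (\<Sum>j\<in>J. g j *\<^sub>C s j v) \<in> M (line v)"
  shows "local_frame m M U J s"
  unfolding local_frame_def
proof (intro conjI ballI allI impI)
  show "M (line v) = {\<Sum>j\<in>J. g j *\<^sub>C s j v | g. True}" if "v \<in> U" for v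
    using assms(5,6)[OF that] by blast
qed (use assms(1-4) in blast)+

lemma subbundleI:
  assumes frame: "\<And>v0. v0 \<in> Sym m - {0} \<Longrightarrow> \<exists>U (J :: 'j set) s. local_frame m M U J s \<and> v0 \<in> U"
  shows "subbundle m M"
  unfolding subbundle_def
proof
  fix v0 assume "v0 \<in> Sym m - {0}"
  from frame[OF this] obtain U and J :: "'j set" and s where "v0 \<in> U" and fr: "local_frame m M U J s"
    by blast
  then have U: "zariski_open m U" "v0 \<in> U" and J: "finite J"
    and reg: "\<And>j. j \<in> J \<Longrightarrow> regular 0 U (s j)"
    and indep: "\<And>v g j. v \<in> U \<Longrightarrow> (\<Sum>j\<in>J. g j *\<^sub>C s j v) = 0 \<Longrightarrow> j \<in> J \<Longrightarrow> g j = 0"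
    and span: "\<And>v. v \<in> U \<Longrightarrow> M (line v) = {\<Sum>j\<in>J. g j *\<^sub>C s j v | g. True}"
    by (simp_all add: local_frame_def)
  obtain h where h: "bij_betw h {..<card J} J"
    using ex_bij_betw_nat_finite[OF J] by (auto simp: atLeast0LessThan)
  define h' where "h' = inv_into {..<card J} h"
  have h': "h' (h i) = i" if "i < card J" for i
    using h that by (simp add: h'_def bij_betw_def inv_into_f_f)
  have sum_h: "(\<Sum>i<card J. g i *\<^sub>C s (h i) v) = (\<Sum>j\<in>J. g (h' j) *\<^sub>C s j v)" for g v
    using sum.reindex_bij_betw[OF h, of "\<lambda>j. g (h' j) *\<^sub>C s j v"] by (simp add: h')
  have indep': "g i = 0" if "v \<in> U" "(\<Sum>i<card J. g i *\<^sub>C s (h i) v) = 0" "i < card J" for g i v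
    using indep[OF that(1), of "\<lambda>j. g (h' j)" "h i"] that bij_betwE[OF h] by (auto simp: sum_h h')
  \<comment> \<open>Equal values would satisfy a relation with coefficients \<open>1\<close> and
    \<open>- 1\<close>.\<close>
  have inj: "inj_on (\<lambda>i. s (h i) v) {..<card J}" if v: "v \<in> U" for v
  proof (rule inj_onI, rule ccontr)
    fix i k assume ik: "i \<in> {..<card J}" "k \<in> {..<card J}" "s (h i) v = s (h k) v" "i \<noteq> k"
    let ?g = "\<lambda>l. (if l = i then 1 else 0) - (if l = k then 1 else 0) :: complex"
    have "(\<Sum>l<card J. ?g l *\<^sub>C s (h l) v) = s (h i) v - s (h k) v"
      using ik by (simp add: cvec.scale_left_diff_distrib sum_subtractf if_distrib[of "\<lambda>a. a *\<^sub>C _"]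
        cong: if_cong)
    then have "?g i = 0"
      using ik v by (intro indep'[of v ?g i]) auto
    then show False using ik by simp
  qed
  have "cvec.independent ((\<lambda>i. s (h i) v) ` {..<card J})" if v: "v \<in> U" for v
    unfolding cvec.dependent_finite[OF finite_imageI[OF finite_lessThan]]
      sum_cscale_reindex[OF inj[OF v]]
    using indep'[OF v, of "\<lambda>i. _ (s (h i) v)"] by auto
  moreover have "M (line v) = cvec.span ((\<lambda>i. s (h i) v) ` {..<card J})" if v: "v \<in> U" for v
  proof -
    have "{\<Sum>j\<in>J. g j *\<^sub>C s j v | g. True} = range (\<lambda>u. \<Sum>i<card J. u (s (h i) v) *\<^sub>C s (h i) v)"
      (is "?L = ?R")
    proof (intro equalityI subsetI)
      fix x assume "x \<in> ?L"
      then obtain g where g: "x = (\<Sum>j\<in>J. g j *\<^sub>C s j v)" by blast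
      \<comment> \<open>Coefficients on a set of vectors are functions of the vector; injectivity
        makes the passage from indices well defined.\<close>
      define u where "u w = g (h (inv_into {..<card J} (\<lambda>i. s (h i) v) w))" for w
      have "u (s (h i) v) = g (h i)" if "i < card J" for i
        using inv_into_f_f[OF inj[OF v], of i] that by (simp add: u_def)
      then have "x = (\<Sum>i<card J. u (s (h i) v) *\<^sub>C s (h i) v)"
        using sum.reindex_bij_betw[OF h, of "\<lambda>j. g j *\<^sub>C s j v"] by (simp add: g)
      then show "x \<in> ?R" by blast
    next
      fix x assume "x \<in> ?R"
      then obtain u where "x = (\<Sum>i<card J. u (s (h i) v) *\<^sub>C s (h i) v)" by blast
      then show "x \<in> ?L"
        using sum_h[of "\<lambda>i. u (s (h i) v)" v] by auto
    qed
    then show ?thesis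
      unfolding span[OF v] cvec.span_finite[OF finite_imageI[OF finite_lessThan]]
        sum_cscale_reindex[OF inj[OF v]] .
  qed
  ultimately show "\<exists>U r s. zariski_open m U \<and> v0 \<in> U \<and> (\<forall>i<r. regular 0 U (s i)) \<and>
      (\<forall>v\<in>U. inj_on (\<lambda>i :: nat. s i v) {..<r} \<and> cvec.independent ((\<lambda>i. s i v) ` {..<r}) \<and>
        M (line v) = cvec.span ((\<lambda>i. s i v) ` {..<r}))"
    using U reg inj bij_betwE[OF h]
    by (intro exI[of _ U] exI[of _ "card J"] exI[of _ "\<lambda>i. s (h i)"]) auto
qed

lemma finite_basis_Ext2:
  assumes "cvec.subspace M" "M \<subseteq> Ext2 m"
  shows "\<exists>B. finite B \<and> (\<forall>g. (\<Sum>b\<in>B. g b *\<^sub>C b) = 0 \<longrightarrow> (\<forall>b\<in>B. g b = 0)) \<and>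
    M = {\<Sum>b\<in>B. g b *\<^sub>C b | g. True}"
proof -
  obtain B where B: "B \<subseteq> M" "cvec.independent B" "M \<subseteq> cvec.span B"
    by (rule cvec.basis_exists)
  have fin: "finite B"
    using cvec.independent_span_bound[OF finite_imageI[OF finite_pairs] B(2)] B(1) assms(2)
      Ext2_subset_span by blast
  have "M = cvec.span B"
    using B assms(1) by (simp add: cvec.span_minimal subset_antisym)
  then have "M = {\<Sum>b\<in>B. g b *\<^sub>C b | g. True}"
    unfolding cvec.span_finite[OF fin] by auto
  moreover have "\<forall>b\<in>B. g b = 0" if "(\<Sum>b\<in>B. g b *\<^sub>C b) = 0" for g
    using B(2) that unfolding cvec.dependent_finite[OF fin] by blast
  ultimately show ?thesis
    using fin by (intro exI[of _ B]) simp
qed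

lemma subbundle_const:
  assumes "cvec.subspace M" "M \<subseteq> Ext2 m"
  shows "subbundle m (\<lambda>_. M)"
proof (rule subbundleI)
  fix v0 assume v0: "v0 \<in> Sym m - {0}"
  from finite_basis_Ext2[OF assms] obtain B where
    "finite B \<and> (\<forall>g. (\<Sum>b\<in>B. g b *\<^sub>C b) = 0 \<longrightarrow> (\<forall>b\<in>B. g b = 0)) \<and>
      M = {\<Sum>b\<in>B. g b *\<^sub>C b | g. True}" ..
  then have "local_frame m (\<lambda>_. M) (Sym m - {0}) B (\<lambda>b _. b)"
    unfolding local_frame_def by (simp add: zariski_open_full regular_const)
  then show "\<exists>U (J :: cbivector set) s. local_frame m (\<lambda>_. M) U J s \<and> v0 \<in> U"
    using v0 by (intro exI conjI)
qed

lemma subbundle_line: "subbundle m (\<lambda>L. L)"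
proof (rule subbundleI)
  fix v0 assume v0: "v0 \<in> Sym m - {0}"
  then obtain j where j: "v0 j \<noteq> 0"
    by (auto simp: fun_eq_iff)
  let ?U = "{v \<in> Sym m - {0}. v j \<noteq> 0}"
  have "local_frame m (\<lambda>L. L) ?U {()} (\<lambda>_ v. (1 / v j) *\<^sub>C v)"
  proof (rule local_frameI)
    show "\<exists>g. x = (\<Sum>i\<in>{()}. g i *\<^sub>C (1 / v j) *\<^sub>C v)" if v: "v \<in> ?U" and x: "x \<in> line v" for v x
    proof -
      obtain c where "x = c *\<^sub>C v" using x unfolding line_eq by blast
      then show ?thesis using v by (intro exI[of _ "\<lambda>_. c * v j"]) simp
    qed
    show "(\<Sum>i\<in>{()}. g i *\<^sub>C (1 / v j) *\<^sub>C v) \<in> line v" for v g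
      by (simp add: cvec.span_scale cvec.span_base)
    show "zariski_open m ?U" "regular 0 ?U (\<lambda>v. (1 / v j) *\<^sub>C v)"
      by (rule zariski_open_coord, rule regular_divide_coord, rule hp_coord)
  qed auto
  then show "\<exists>U (J :: unit set) s. local_frame m (\<lambda>L. L) U J s \<and> v0 \<in> U"
    using v0 j by (intro exI conjI) (assumption, simp)
qed

text \<open>For a family strictly linear in the vector and polynomial of degree
  \<open>\<delta>\<close> in the point, all congruences modulo \<open>den B\<close> are equalities,
  so having \<open>0\<close> in \<open>den B\<close> settles them. A local quotient of
  \<open>p\<close> by \<open>h\<close> goes to that of \<open>T p\<close> by \<open>h\<close>, whose
  degree is higher by \<open>\<delta>\<close>: the difference of the twists.\<close>

lemma bundle_morphismI:
  assumes num: "\<And>v a. v \<in> Sym m - {0} \<Longrightarrow> a \<in> num A (line v) \<Longrightarrow> T v a \<in> num B (line v)"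
    and den: "\<And>v a. v \<in> Sym m - {0} \<Longrightarrow> a \<in> den A (line v) \<Longrightarrow> T v a \<in> den B (line v)"
    and zero: "\<And>v. v \<in> Sym m - {0} \<Longrightarrow> 0 \<in> den B (line v)"
    and add: "\<And>v a b. T v (a + b) = T v a + T v b"
    and scale: "\<And>v c a. T v (c *\<^sub>C a) = c *\<^sub>C T v a"
    and homog: "\<And>v c a. T (c *\<^sub>C v) a = (c ^ \<delta>) *\<^sub>C T v a"
    and poly: "\<And>e p j. (\<And>i. homogeneous_poly e (\<lambda>v. p v i)) \<Longrightarrow>
      homogeneous_poly (e + \<delta>) (\<lambda>v. T v (p v) j)"
    and twist: "twist B = twist A + int \<delta>"
  shows "bundle_morphism m A B T"
proof -
  have diff: "T v (a - b) = T v a - T v b" for v a b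
    using add[of v "a - b" b] by simp
  have reg: "regular (twist B) U (\<lambda>v. T v (s v))" if "regular (twist A) U s" for U s
    unfolding regular_def
  proof
    fix v0 assume "v0 \<in> U"
    from bspec[OF that[unfolded regular_def] this] obtain d e h p where
      *: "homogeneous_poly d h \<and> (\<forall>i. homogeneous_poly e (\<lambda>v. p v i)) \<and> int e - int d = twist A \<and>
        h v0 \<noteq> 0 \<and> (\<forall>v\<in>U. h v \<noteq> 0 \<longrightarrow> s v = (1 / h v) *\<^sub>C p v)"
      by (elim exE)
    show "\<exists>d e h p. homogeneous_poly d h \<and> (\<forall>i. homogeneous_poly e (\<lambda>v. p v i)) \<and>
        int e - int d = twist B \<and> h v0 \<noteq> 0 \<and>
        (\<forall>v\<in>U. h v \<noteq> 0 \<longrightarrow> T v (s v) = (1 / h v) *\<^sub>C p v)"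
      using * poly[of e p] twist
      by (intro exI[of _ d] exI[of _ "e + \<delta>"] exI[of _ h] exI[of _ "\<lambda>v. T v (p v)"])
        (auto simp: scale)
  qed
  have "bundle_section m B U (\<lambda>v. T v (s v))"
    if U: "zariski_open m U" and s: "bundle_section m A U s" for U s
    unfolding bundle_section_def
  proof (intro conjI ballI)
    have sub: "zariski_open m U' \<Longrightarrow> U' \<subseteq> Sym m - {0}" for U'
      by (auto simp: zariski_open_def)
    show "T v (s v) \<in> num B (line v)" if "v \<in> U" for v
      using s that sub[OF U] num by (auto simp: bundle_section_def)
    fix v0 assume "v0 \<in> U"
    then obtain U' s' where U': "zariski_open m U'" "v0 \<in> U'" "U' \<subseteq> U" "regular (twist A) U' s'"
      "\<forall>v\<in>U'. s v - s' v \<in> den A (line v)"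
      using s unfolding bundle_section_def by blast
    have "\<forall>v\<in>U'. T v (s v) - T v (s' v) \<in> den B (line v)"
      using U'(5) sub[OF U'(1)] den by (auto simp flip: diff)
    then show "\<exists>U' s'. zariski_open m U' \<and> v0 \<in> U' \<and> U' \<subseteq> U \<and> regular (twist B) U' s' \<and>
        (\<forall>v\<in>U'. T v (s v) - s' v \<in> den B (line v))"
      using U' reg by blast
  qed
  then show ?thesis
    unfolding bundle_morphism_def using num den zero
    by (auto simp: add scale homog twist)
qed

section \<open>Linearity of the weight forms and of the wedge\<close>

lemma weight_form_add: "weight_form m c k (x + y) = weight_form m c k x + weight_form m c k y"
  by (simp add: weight_form_def distrib_left sum.distrib)

lemma weight_form_scale: "weight_form m c k (a *\<^sub>C x) = a * weight_form m c k x"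
  by (simp add: weight_form_def cscale_apply sum_distrib_left ac_simps)

lemma weight_form_zero: "weight_form m c k 0 = 0"
  by (simp add: weight_form_def)

lemma weight_form_sum: "weight_form m c k (\<Sum>i\<in>A. x i) = (\<Sum>i\<in>A. weight_form m c k (x i))"
  by (induction A rule: infinite_finite_induct)
    (simp_all only: sum.infinite sum.empty sum.insert weight_form_add weight_form_zero not_False_eq_True)

lemma weight_form_diff: "weight_form m c k (x - y) = weight_form m c k x - weight_form m c k y"
  using weight_form_add[of m c k "x - y" y] by simp

lemma weight_form_E: "x \<in> E m j \<Longrightarrow> j \<noteq> k \<Longrightarrow> weight_form m c k x = 0"
  unfolding weight_form_def by (rule sum.neutral) (auto simp: E_eq wpairs_def)

lemma basis_wedge_pairs:
  assumes "y \<in> pairs m" "z \<in> pairs m"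
  shows "basis_wedge y z = (if y = z then 1 else 0)"
proof -
  obtain i j where z: "z = (i, j)" by (cases z)
  have "y \<noteq> (j, i)" using assms z by (auto simp: pairs_def)
  then show ?thesis unfolding z basis_wedge_apply by simp
qed

lemma weight_form_basis_wedge:
  assumes "y \<in> pairs m"
  shows "weight_form m c k (basis_wedge y) = (if y \<in> wpairs m k then c y else 0)"
proof -
  have "weight_form m c k (basis_wedge y) = (\<Sum>z\<in>wpairs m k. if z = y then c z else 0)"
    unfolding weight_form_def
  proof (intro sum.cong refl)
    fix z assume "z \<in> wpairs m k"
    then have "z \<in> pairs m" using wpairs_subset_pairs by blast
    from basis_wedge_pairs[OF assms this]
    show "c z * basis_wedge y z = (if z = y then c z else 0)" by simp
  qed
  then show ?thesis by simp
qed

lemma wedge_zero_right: "wedge v 0 = 0"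
  by (auto simp: wedge_def fun_eq_iff)

lemma wedge_sum_right: "wedge v (\<Sum>i\<in>A. a i) = (\<Sum>i\<in>A. wedge v (a i))"
  by (induction A rule: infinite_finite_induct)
    (simp_all only: sum.infinite sum.empty sum.insert wedge_add_right wedge_zero_right
      not_False_eq_True)

lemma wedge_diff_right: "wedge v (a - b) = wedge v a - wedge v b"
  using wedge_add_right[of v "a - b" b] by simp

lemma wedge_self: "wedge v v = 0"
  by (auto simp: wedge_def fun_eq_iff)

text \<open>Computed fibres such as those of \<open>N m f\<close> are known only at lines of nonzero
  points of \<open>Sym m\<close>; nothing else matters.\<close>

lemma subbundle_cong:
  assumes "\<And>v. v \<in> Sym m - {0} \<Longrightarrow> M (line v) = M' (line v)"
  shows "subbundle m M \<longleftrightarrow> subbundle m M'"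
proof -
  have "M (line v) = M' (line v)" if "zariski_open m U" "v \<in> U" for U v
    using assms that by (auto simp: zariski_open_def)
  then show ?thesis
    unfolding subbundle_def
    by (intro ball_cong refl arg_cong[where f = Ex] ext conj_cong) auto
qed

section \<open>The null correlation attached to a Tango subspace\<close>

locale tango_hyperplanes =
  fixes n m :: nat and c :: cbivector and W :: "cbivector set"
  assumes m: "m = 2 * n + 1"
    and c_nonzero: "\<And>y. y \<in> pairs m \<Longrightarrow> c y \<noteq> 0"
    and c_lead: "\<And>k. k \<in> {1..2 * m - 1} \<Longrightarrow> c (lead m k) = 1"
    and W_eq: "W = {x \<in> Ext2 m. \<forall>k\<in>{1..2 * m - 1}. weight_form m c k x = 0}"
    and indecomposable: "\<And>u v. u \<in> Sym m \<Longrightarrow> v \<in> Sym m \<Longrightarrow> wedge u v \<in> W \<Longrightarrow> wedge u v = 0"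
begin

definition K :: "nat set" where "K = {1..2 * m - 1}"

abbreviation L :: "nat \<Rightarrow> cbivector \<Rightarrow> complex" where "L \<equiv> weight_form m c"

definition lincomb :: "nat set \<Rightarrow> (nat \<Rightarrow> complex) \<Rightarrow> cbivector"
  where "lincomb S g = (\<Sum>k\<in>S. g k *\<^sub>C basis_wedge (lead m k))"

text \<open>The factors \<open>(fact p * fact q)^2\<close> are the values of \<open>ext_form\<close> on the basis bivectors of
  weight \<open>m\<close>, so that \<open>f\<close> represents the linear form \<open>L m\<close>.\<close>

definition f :: cbivector
  where "f = (\<lambda>(p, q). if p + q = m
    then (if p < q then c (p, q) else - c (q, p)) / (fact p * fact q)\<^sup>2 else 0)"

text \<open>One vector for each weight: the lead, except in weight \<open>m\<close>, where
  \<open>f\<close> takes its place.\<close>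

definition D :: "cbivector set"
  where "D = {a *\<^sub>C f + lincomb (K - {m}) g | a g. True}"

text \<open>\<open>wedge v u\<close> modulo \<open>W\<close> in the basis of leads. The omitted
  coordinate, of weight \<open>m\<close>, is the one that vanishes on the fibres of
  \<open>N m f\<close>.\<close>

definition \<phi> :: "cvector \<Rightarrow> cvector \<Rightarrow> cbivector"
  where "\<phi> v u = lincomb (K - {m}) (\<lambda>k. L k (wedge v u))"

text \<open>On \<open>D\<close> this is the projection along \<open>f\<close> onto the remaining
  leads, the same for all \<open>v\<close>; it identifies \<open>D\<close> modulo \<open>f\<close>
  with the kernel of \<open>L m\<close> modulo \<open>W\<close>.\<close>

definition \<psi> :: "cvector \<Rightarrow> cbivector \<Rightarrow> cbivector"
  where "\<psi> v x = lincomb (K - {m}) (\<lambda>k. x (lead m k))"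

text \<open>Replaces \<open>d\<close> by the combination of leads with the same lead entries. This
  moves \<open>f\<close>, which may lie in \<open>W\<close>, to a nonzero multiple of the lead of
  weight \<open>m\<close>, which never does.\<close>

definition \<Phi> :: "cbivector \<times> cbivector \<Rightarrow> cbivector"
  where "\<Phi> = (\<lambda>(d, w). lincomb K (\<lambda>k. d (lead m k)) + w)"

section \<open>The leads as coordinates modulo \<open>W\<close>\<close>

lemma finite_K [simp]: "finite K"
  by (simp add: K_def)

lemma m_in_K: "m \<in> K"
  unfolding K_def using m by simp

lemma c_lead_K: "k \<in> K \<Longrightarrow> c (lead m k) = 1"
  unfolding K_def by (rule c_lead)

lemma lead_wpairs: "k \<in> K \<Longrightarrow> lead m k \<in> wpairs m k"
  unfolding K_def by (rule lead_in_wpairs)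

lemma lead_pairs: "k \<in> K \<Longrightarrow> lead m k \<in> pairs m"
  using lead_wpairs wpairs_subset_pairs by blast

lemma lead_wpairs_iff: "k \<in> K \<Longrightarrow> lead m k \<in> wpairs m j \<longleftrightarrow> k = j"
  using lead_wpairs[of k] by (auto simp: wpairs_def)

lemma lead_eq_iff: "k \<in> K \<Longrightarrow> j \<in> K \<Longrightarrow> lead m k = lead m j \<longleftrightarrow> k = j"
  using lead_wpairs[of j] lead_wpairs_iff by metis

lemma lincomb_lead:
  assumes "S \<subseteq> K" "j \<in> K"
  shows "lincomb S g (lead m j) = (if j \<in> S then g j else 0)"
proof -
  have "lincomb S g (lead m j) = (\<Sum>k\<in>S. if k = j then g k else 0)"
    unfolding lincomb_def sum_fun_apply
  proof (intro sum.cong refl)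
    fix k assume "k \<in> S"
    then have k: "k \<in> K" using assms by blast
    show "(g k *\<^sub>C basis_wedge (lead m k)) (lead m j) = (if k = j then g k else 0)"
      using k assms(2) basis_wedge_pairs[OF lead_pairs[OF k] lead_pairs[OF assms(2)]]
      by (simp add: cscale_apply lead_eq_iff)
  qed
  also have "\<dots> = (if j \<in> S then g j else 0)"
    using finite_subset[OF assms(1) finite_K] by simp
  finally show ?thesis .
qed

text \<open>Compared with \<open>lincomb_lead\<close>: on combinations of leads, \<open>L j\<close>
  and the entry at \<open>lead m j\<close> are the same functional.\<close>

lemma L_lincomb:
  assumes "S \<subseteq> K" "j \<in> K"
  shows "L j (lincomb S g) = (if j \<in> S then g j else 0)"
proof -
  have "L j (lincomb S g) = (\<Sum>k\<in>S. if k = j then g k else 0)"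
    unfolding lincomb_def weight_form_sum
  proof (intro sum.cong refl)
    fix k assume "k \<in> S"
    then have k: "k \<in> K" using assms by blast
    show "L j (g k *\<^sub>C basis_wedge (lead m k)) = (if k = j then g k else 0)"
      using k weight_form_basis_wedge[OF lead_pairs[OF k], of c j]
      by (simp add: weight_form_scale lead_wpairs_iff c_lead_K[OF assms(2)])
  qed
  also have "\<dots> = (if j \<in> S then g j else 0)"
    using finite_subset[OF assms(1) finite_K] by simp
  finally show ?thesis .
qed

lemma lincomb_in_Ext2:
  assumes "S \<subseteq> K"
  shows "lincomb S g \<in> Ext2 m"
  unfolding lincomb_def using assms
  by (intro cvec.subspace_sum[OF subspace_Ext2] cvec.subspace_scale[OF subspace_Ext2]
      basis_wedge_in_Ext2 lead_pairs) blast

lemma lincomb_add: "lincomb S (\<lambda>k. g k + h k) = lincomb S g + lincomb S h"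
  by (simp add: lincomb_def cvec.scale_left_distrib sum.distrib)

lemma lincomb_scale: "lincomb S (\<lambda>k. a * g k) = a *\<^sub>C lincomb S g"
  by (simp add: lincomb_def cvec.scale_sum_right)

lemma lincomb_zero: "(\<And>k. k \<in> S \<Longrightarrow> g k = 0) \<Longrightarrow> lincomb S g = 0"
  by (simp add: lincomb_def)

lemma lincomb_cong: "(\<And>k. k \<in> S \<Longrightarrow> g k = h k) \<Longrightarrow> lincomb S g = lincomb S h"
  by (simp add: lincomb_def)

lemma W_iff: "x \<in> W \<longleftrightarrow> x \<in> Ext2 m \<and> (\<forall>k\<in>K. L k x = 0)"
  by (simp add: W_eq K_def)

lemma subspace_W: "cvec.subspace W"
  using subspace_Ext2[of m]
  by (auto simp: cvec.subspace_def W_iff weight_form_add weight_form_scale weight_form_zero)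

lemma W_Ext2: "W \<subseteq> Ext2 m"
  by (auto simp: W_iff)

section \<open>The symplectic form of weight \<open>m\<close>\<close>

lemma f_in_E: "f \<in> E m m"
proof -
  \<comment> \<open>\<open>m\<close> is odd, so no diagonal position has weight \<open>m\<close>; on
    one, the case split in \<open>f\<close> would break antisymmetry.\<close>
  have "p + p \<noteq> m" for p
    unfolding m by presburger
  then have "antisym_array f"
    by (auto simp: antisym_array_def f_def add.commute mult.commute)
  then show ?thesis
    by (auto simp: E_eq Ext2_eq f_def)
qed

lemma f_in_Ext2: "f \<in> Ext2 m"
  using f_in_E E_subset_Ext2 by blast

lemma f_lead: "k \<in> K \<Longrightarrow> f (lead m k) = 0 \<longleftrightarrow> k \<noteq> m"
  using lead_wpairs[of k] lead_pairs[of k] c_nonzero[of "lead m k"]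
  by (cases "lead m k") (auto simp: f_def wpairs_def)

lemma L_f: "k \<noteq> m \<Longrightarrow> L k f = 0"
  using weight_form_E[OF f_in_E, of k c] by simp

text \<open>\<open>zvec m i j\<close> pairs only with \<open>zvec m (m - j) (m - i)\<close>, which
  in weight \<open>m\<close> is \<open>zvec m i j\<close> itself; the factorials then form the
  square that \<open>f\<close> carries as denominator.\<close>

lemma ext_form_f:
  assumes g: "g \<in> Ext2 m"
  shows "ext_form m f g = L m g"
proof -
  have P: "{(i, j). i < j \<and> j \<le> m} = pairs m"
    by (simp add: pairs_def)
  let ?k = "\<lambda>i j s t. if j + s = m \<and> i + t = m
    then (- 1) ^ (i + j + 1) * fact i * fact t * fact j * fact s else 0 :: complex"
  have inner: "(\<Sum>(s, t)\<in>pairs m. ?k i j s t * f (m - i, m - j) * g (m - s, m - t)) =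
      (if (i, j) \<in> wpairs m m then c (i, j) * g (i, j) else 0)" if ij: "(i, j) \<in> pairs m" for i j
  proof -
    have lt: "i < j" "j \<le> m" using ij by (auto simp: pairs_def)
    then have mem: "(m - j, m - i) \<in> pairs m" by (auto simp: pairs_def)
    have "(\<Sum>(s, t)\<in>pairs m. ?k i j s t * f (m - i, m - j) * g (m - s, m - t)) =
        (\<Sum>y\<in>pairs m. if y = (m - j, m - i) then ?k i j (m - j) (m - i) * f (m - i, m - j) * g (j, i) else 0)"
      using lt by (intro sum.cong refl) (auto simp: pairs_def split: if_splits)
    also have "\<dots> = ?k i j (m - j) (m - i) * f (m - i, m - j) * g (j, i)"
      using lt mem by simp
    also have "\<dots> = (if (i, j) \<in> wpairs m m then c (i, j) * g (i, j) else 0)"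
    proof (cases "i + j = m")
      case True
      \<comment> \<open>Oddness of \<open>m\<close> makes the sign of the form positive. Both
        \<open>f\<close> and \<open>g\<close> are read at \<open>(j, i)\<close>, and the two sign
        changes cancel.\<close>
      then have e: "m - i = j" "m - j = i" "even (Suc (i + j))" "(i, j) \<in> wpairs m m"
        using lt m by (auto simp: wpairs_def)
      have "g (j, i) = - g (i, j)"
        by (rule Ext2_antisym[OF g])
      moreover have "f (j, i) = - c (i, j) / (fact j * fact i)\<^sup>2"
        using True lt by (simp add: f_def add.commute)
      ultimately show ?thesis
        using e True by (simp add: add.commute power2_eq_square field_simps)
    next
      case False
      then have "m - i + (m - j) \<noteq> m" "(i, j) \<notin> wpairs m m"
        using lt by (auto simp: wpairs_def)
      then show ?thesis by (simp add: f_def)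
    qed
    finally show ?thesis .
  qed
  have "ext_form m f g = (\<Sum>(i, j)\<in>pairs m. if (i, j) \<in> wpairs m m then c (i, j) * g (i, j) else 0)"
    unfolding ext_form_def P using inner by (intro sum.cong refl) auto
  also have "\<dots> = (\<Sum>y\<in>pairs m. if y \<in> wpairs m m then c y * g y else 0)"
    by (intro sum.cong refl) auto
  also have "\<dots> = (\<Sum>y\<in>wpairs m m. c y * g y)"
    using wpairs_subset_pairs by (simp add: sum.If_cases Int_absorb1)
  finally show ?thesis
    by (simp add: weight_form_def)
qed

lemma bilin_f: "u \<in> Sym m \<Longrightarrow> v \<in> Sym m \<Longrightarrow> bilin m f u v = L m (wedge u v)"
  by (simp add: bilin_def ext_form_f wedge_in_Ext2)

text \<open>The antidiagonal entries of the matrix of \<open>L m\<close>: its values on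
  \<open>wedge (monom_vec (m - j)) (monom_vec j)\<close>.\<close>

definition \<gamma> :: "nat \<Rightarrow> complex"
  where "\<gamma> j = (if j < m - j then - c (j, m - j) else c (m - j, j))"

lemma \<gamma>_nonzero: "j \<le> m \<Longrightarrow> \<gamma> j \<noteq> 0"
proof -
  assume "j \<le> m"
  then have "j < m - j \<and> (j, m - j) \<in> pairs m \<or> \<not> j < m - j \<and> (m - j, j) \<in> pairs m"
    unfolding pairs_def m by auto presburger
  then show ?thesis
    using c_nonzero by (auto simp: \<gamma>_def)
qed

lemma L_wedge_monom:
  assumes j: "j \<le> m"
  shows "L m (wedge v (monom_vec j)) = \<gamma> j * v (m - j)"
proof (cases "j < m - j")
  case True
  then have mem: "(j, m - j) \<in> wpairs m m" by (auto simp: wpairs_def)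
  have "L m (wedge v (monom_vec j)) = (\<Sum>y\<in>wpairs m m. if y = (j, m - j) then - c y * v (m - j) else 0)"
    unfolding weight_form_def using True
    by (intro sum.cong refl) (auto simp: wedge_def monom_vec_def wpairs_def split: if_splits)
  also have "\<dots> = \<gamma> j * v (m - j)"
    using True mem by (simp add: \<gamma>_def)
  finally show ?thesis .
next
  case False
  have "j \<noteq> m - j" using j unfolding m by presburger
  then have lt: "m - j < j" using False by simp
  then have mem: "(m - j, j) \<in> wpairs m m" using j by (auto simp: wpairs_def)
  have "L m (wedge v (monom_vec j)) = (\<Sum>y\<in>wpairs m m. if y = (m - j, j) then c y * v (m - j) else 0)"
    unfolding weight_form_def using lt j
    by (intro sum.cong refl) (auto simp: wedge_def monom_vec_def wpairs_def split: if_splits)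
  also have "\<dots> = \<gamma> j * v (m - j)"
    using False mem by (simp add: \<gamma>_def)
  finally show ?thesis .
qed

lemma nondegenerate_f: "nondegenerate m f"
  unfolding nondegenerate_def
proof (intro ballI impI)
  fix u assume u: "u \<in> Sym m" and 0: "\<forall>v\<in>Sym m. bilin m f u v = 0"
  \<comment> \<open>Pairing with \<open>monom_vec (m - j)\<close> isolates \<open>u j\<close>, up to
    the factor \<open>\<gamma> (m - j)\<close>.\<close>
  have "u j = 0" if "j \<le> m" for j
    using 0 bilin_f[OF u, of "monom_vec (m - j)"] L_wedge_monom[of "m - j" u] \<gamma>_nonzero[of "m - j"] that
    by (simp add: monom_vec_in_Sym)
  moreover have "u j = 0" if "\<not> j \<le> m" for j
    using u that by (simp add: Sym_def)
  ultimately show "u = 0"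
    by (metis ext zero_fun_apply)
qed

lemma special_f: "special n f"
proof -
  \<comment> \<open>For \<open>i \<le> n\<close> the entry in row \<open>i\<close> is
    \<open>\<gamma> (m - i) = c (i, m - i)\<close>, which has to be \<open>- r i\<close>.\<close>
  define r where "r i = - c (i, m - i)" for i
  have r: "\<gamma> j = (if j \<le> n then r j else - r (m - j))" if "j \<le> m" for j
    unfolding \<gamma>_def r_def using that m by auto
  have "r i \<noteq> 0" if "i \<le> n" for i
    using \<gamma>_nonzero[of i] r[of i] that m by auto
  moreover have "bilin m f (monom_vec i) (monom_vec j) =
      (if i + j = m then if i \<le> n then - r i else r (m - i) else 0)" if "i \<le> m" "j \<le> m" for i j
  proof -
    have "bilin m f (monom_vec i) (monom_vec j) = \<gamma> j * monom_vec i (m - j)"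
      using that by (simp add: bilin_f monom_vec_in_Sym L_wedge_monom)
    then have "bilin m f (monom_vec i) (monom_vec j) = (if m - j = i then \<gamma> j else 0)"
      by (simp add: monom_vec_def)
    moreover have "j \<le> n \<longleftrightarrow> \<not> i \<le> n" "m - j = i" "m - i = j" if "i + j = m"
      using that m by auto
    ultimately show ?thesis
      using r[of j] that by auto
  qed
  ultimately show ?thesis
    unfolding special_def m[symmetric] by (intro exI[of _ r]) blast
qed

text \<open>A pair with \<open>p + q = m\<close> contributes the exponent
  \<open>(m - p) + (m - q) = m\<close> of the first eigenvalue and \<open>p + q = m\<close> of the
  second, whatever the pair.\<close>

lemma bilin_sigma1:
  assumes t: "t \<noteq> 0"
  shows "\<exists>a. a \<noteq> 0 \<and> (\<forall>u\<in>Sym m. \<forall>v\<in>Sym m.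
    bilin m f (sigma1 \<alpha> \<beta> m t u) (sigma1 \<alpha> \<beta> m t v) = a * bilin m f u v)"
proof (intro exI conjI ballI)
  let ?a = "(t ^ \<alpha>) ^ m * (t powi \<beta>) ^ m"
  show "?a \<noteq> 0" using t by simp
  fix u v assume uv: "u \<in> Sym m" "v \<in> Sym m"
  have S: "sigma1 \<alpha> \<beta> m t u \<in> Sym m" if "u \<in> Sym m" for u
    using that by (auto simp: Sym_def sigma1_def)
  have "L m (wedge (sigma1 \<alpha> \<beta> m t u) (sigma1 \<alpha> \<beta> m t v)) = ?a * L m (wedge u v)"
    unfolding weight_form_def sum_distrib_left
  proof (intro sum.cong refl)
    fix y assume "y \<in> wpairs m m"
    then obtain p q where y: "y = (p, q)" "p + q = m" by (auto simp: wpairs_def)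
    then have "m - p = q" "m - q = p" by auto
    moreover have "?a = (t ^ \<alpha>) ^ p * (t ^ \<alpha>) ^ q * ((t powi \<beta>) ^ p * (t powi \<beta>) ^ q)"
      by (simp only: y(2)[symmetric] power_add)
    ultimately show "c y * wedge (sigma1 \<alpha> \<beta> m t u) (sigma1 \<alpha> \<beta> m t v) y = ?a * (c y * wedge u v y)"
      by (simp add: y(1) wedge_def sigma1_def algebra_simps)
  qed
  then show "bilin m f (sigma1 \<alpha> \<beta> m t u) (sigma1 \<alpha> \<beta> m t v) = ?a * bilin m f u v"
    using uv S by (simp add: bilin_f)
qed

subsection \<open>The complement\<close>

lemma D_cases:
  assumes "x \<in> D"
  obtains a g where "x = a *\<^sub>C f + lincomb (K - {m}) g"
  using assms unfolding D_def by blast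

lemma in_D: "a *\<^sub>C f + lincomb (K - {m}) g \<in> D"
  unfolding D_def by blast

lemma f_in_D: "f \<in> D"
  using in_D[of 1 "\<lambda>_. 0"] by (simp add: lincomb_def)

lemma lincomb_in_D: "lincomb (K - {m}) g \<in> D"
  using in_D[of 0 g] by simp

lemma subspace_D: "cvec.subspace D"
proof (rule cvec.subspaceI)
  show "0 \<in> D"
    using lincomb_in_D[of "\<lambda>_. 0"] by (simp add: lincomb_def)
  fix x y a assume "x \<in> D" "y \<in> D"
  then obtain s g s' g' where xy: "x = s *\<^sub>C f + lincomb (K - {m}) g" "y = s' *\<^sub>C f + lincomb (K - {m}) g'"
    by (elim D_cases)
  have "x + y = (s + s') *\<^sub>C f + lincomb (K - {m}) (\<lambda>k. g k + g' k)"
    by (simp add: xy lincomb_add cvec.scale_left_distrib)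
  then show "x + y \<in> D"
    using in_D by simp
  have "a *\<^sub>C x = (a * s) *\<^sub>C f + lincomb (K - {m}) (\<lambda>k. a * g k)"
    by (simp add: xy lincomb_scale cvec.scale_right_distrib)
  then show "a *\<^sub>C x \<in> D"
    using in_D by simp
qed

lemma D_Ext2: "D \<subseteq> Ext2 m"
proof
  fix x assume "x \<in> D"
  then obtain a g where "x = a *\<^sub>C f + lincomb (K - {m}) g" by (rule D_cases)
  then show "x \<in> Ext2 m"
    using cvec.subspace_add[OF subspace_Ext2 cvec.subspace_scale[OF subspace_Ext2 f_in_Ext2] lincomb_in_Ext2]
    by blast
qed

lemma D_lead:
  assumes "k \<in> K"
  shows "(a *\<^sub>C f + lincomb (K - {m}) g) (lead m k) = (if k = m then a * f (lead m m) else g k)"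
  using assms f_lead[of k] by (simp add: cscale_apply lincomb_lead)

text \<open>The entry at \<open>lead m m\<close> sees only the \<open>f\<close> component, each
  other lead entry only its own lead.\<close>

lemma D_eqI:
  assumes "x \<in> D" "y \<in> D" "\<And>k. k \<in> K \<Longrightarrow> x (lead m k) = y (lead m k)"
  shows "x = y"
proof -
  obtain a g b h where xy: "x = a *\<^sub>C f + lincomb (K - {m}) g" "y = b *\<^sub>C f + lincomb (K - {m}) h"
    using assms(1,2) by (elim D_cases)
  have "a = b"
    using assms(3)[OF m_in_K] f_lead[OF m_in_K] unfolding xy D_lead[OF m_in_K] by simp
  moreover have "lincomb (K - {m}) g = lincomb (K - {m}) h"
  proof (rule lincomb_cong)
    fix k assume k: "k \<in> K - {m}"
    then have "k \<in> K" by blast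
    with k show "g k = h k"
      using assms(3)[of k] unfolding xy D_lead[OF \<open>k \<in> K\<close>] by simp
  qed
  ultimately show ?thesis
    by (simp add: xy)
qed

lemma torus_invariant_D: "torus_invariant m D"
  unfolding torus_invariant_def
proof (intro conjI D_Ext2 subspace_D equalityI)
  show "cvec.span (\<Union>k\<in>{1..2 * m - 1}. D \<inter> E m k) \<subseteq> D"
    by (rule cvec.span_minimal[OF _ subspace_D]) blast
  show "D \<subseteq> cvec.span (\<Union>k\<in>{1..2 * m - 1}. D \<inter> E m k)"
  proof
    fix x assume "x \<in> D"
    then obtain a g where x: "x = a *\<^sub>C f + lincomb (K - {m}) g" by (rule D_cases)
    have "f \<in> (\<Union>k\<in>{1..2 * m - 1}. D \<inter> E m k)"
      using f_in_D f_in_E m_in_K unfolding K_def by blast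
    moreover have "basis_wedge (lead m k) \<in> (\<Union>k\<in>{1..2 * m - 1}. D \<inter> E m k)" if k: "k \<in> K - {m}" for k
    proof -
      have "basis_wedge (lead m k) = (\<Sum>j\<in>K - {m}. if j = k then basis_wedge (lead m j) else 0)"
        using k by (simp add: sum.delta)
      also have "\<dots> = lincomb (K - {m}) (\<lambda>j. if j = k then 1 else 0)"
        unfolding lincomb_def by (intro sum.cong refl) auto
      finally have "basis_wedge (lead m k) \<in> D"
        using lincomb_in_D by simp
      moreover have "basis_wedge (lead m k) \<in> E m k"
        using k by (intro basis_wedge_in_E lead_wpairs) blast
      ultimately show ?thesis
        using k unfolding K_def by blast
    qed
    ultimately show "x \<in> cvec.span (\<Union>k\<in>{1..2 * m - 1}. D \<inter> E m k)"
      unfolding x lincomb_def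
      by (intro cvec.span_add cvec.span_sum cvec.span_scale cvec.span_base)
  qed
qed

text \<open>The leads span a complement of \<open>W\<close> on which the \<open>L k\<close> are
  coordinates.\<close>

lemma reduce_mod_W:
  assumes "x \<in> Ext2 m"
  shows "x - lincomb K (\<lambda>k. L k x) \<in> W"
  using assms cvec.subspace_diff[OF subspace_Ext2 assms lincomb_in_Ext2[of K]]
  by (simp add: W_iff weight_form_diff L_lincomb)

text \<open>The forms \<open>L k\<close> vanish on \<open>W\<close> and return the lead entries of
  \<open>d\<close>, so \<open>d\<close>, and then \<open>w\<close>, can be recovered.\<close>

lemma direct_sum_iso_\<Phi>: "direct_sum_iso m D W \<Phi>"
  unfolding direct_sum_iso_def
proof (intro conjI ballI allI)
  have L_\<Phi>: "L k (\<Phi> (d, w)) = d (lead m k)" if "w \<in> W" "k \<in> K" for d w k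
    using that by (simp add: \<Phi>_def weight_form_add L_lincomb W_iff)
  show "bij_betw \<Phi> (D \<times> W) (Ext2 m)"
  proof (rule bij_betwI')
    fix y z assume "y \<in> D \<times> W" "z \<in> D \<times> W"
    then obtain d w d' w' where yz: "y = (d, w)" "z = (d', w')" "d \<in> D" "w \<in> W" "d' \<in> D" "w' \<in> W"
      by blast
    show "\<Phi> y = \<Phi> z \<longleftrightarrow> y = z"
    proof
      assume eq: "\<Phi> y = \<Phi> z"
      have "d = d'"
      proof (rule D_eqI[OF yz(3,5)])
        fix k assume "k \<in> K"
        then show "d (lead m k) = d' (lead m k)"
          using L_\<Phi>[OF yz(4), of k d] L_\<Phi>[OF yz(6), of k d'] eq by (simp add: yz(1,2))
      qed
      then show "y = z"
        using eq by (simp add: yz(1,2) \<Phi>_def)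
    qed simp
  next
    fix y assume "y \<in> D \<times> W"
    then show "\<Phi> y \<in> Ext2 m"
      using W_Ext2 by (auto simp: \<Phi>_def intro!: cvec.subspace_add[OF subspace_Ext2] lincomb_in_Ext2)
  next
    fix x assume x: "x \<in> Ext2 m"
    \<comment> \<open>Dividing by the lead entry of \<open>f\<close> gives \<open>d\<close> the lead
      entries \<open>L k x\<close> in all weights, \<open>m\<close> included.\<close>
    define d where "d = (L m x / f (lead m m)) *\<^sub>C f + lincomb (K - {m}) (\<lambda>k. L k x)"
    have "d (lead m k) = L k x" if "k \<in> K" for k
      using f_lead[OF m_in_K] unfolding d_def D_lead[OF that] by simp
    then have "lincomb K (\<lambda>k. d (lead m k)) = lincomb K (\<lambda>k. L k x)"
      by (rule lincomb_cong)
    then have "x = \<Phi> (d, x - lincomb K (\<lambda>k. L k x))"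
      by (simp add: \<Phi>_def)
    moreover have "d \<in> D"
      unfolding d_def by (rule in_D)
    ultimately show "\<exists>y\<in>D \<times> W. x = \<Phi> y"
      using reduce_mod_W[OF x] by blast
  qed
  show "\<Phi> (d + d', w + w') = \<Phi> (d, w) + \<Phi> (d', w')" for d d' w w'
    by (simp add: \<Phi>_def lincomb_add)
  show "\<Phi> (a *\<^sub>C d, a *\<^sub>C w) = a *\<^sub>C \<Phi> (d, w)" for a d w
    by (simp add: \<Phi>_def lincomb_scale cscale_apply cvec.scale_right_distrib)
  fix k d w assume k: "k \<in> {1..2 * m - 1}" and d: "d \<in> D \<inter> E m k" and w: "w \<in> W \<inter> E m k"
  \<comment> \<open>A \<open>d\<close> of weight \<open>k\<close> can have a nonzero lead entry only
    in weight \<open>k\<close>.\<close>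
  have "d (lead m j) *\<^sub>C basis_wedge (lead m j) \<in> E m k" if j: "j \<in> K" for j
  proof (cases "j = k")
    case True
    then show ?thesis
      using j by (auto intro!: cvec.subspace_scale[OF subspace_E] basis_wedge_in_E lead_wpairs)
  next
    case False
    then have "d (lead m j) = 0"
      using d lead_wpairs[OF j] by (cases "lead m j") (auto simp: E_eq wpairs_def)
    then show ?thesis
      using cvec.subspace_0[OF subspace_E] by simp
  qed
  then have "lincomb K (\<lambda>j. d (lead m j)) \<in> E m k"
    unfolding lincomb_def by (rule cvec.subspace_sum[OF subspace_E])
  then show "\<Phi> (d, w) \<in> E m k"
    using w by (auto simp: \<Phi>_def intro: cvec.subspace_add[OF subspace_E])
qed

text \<open>Only \<open>L m\<close> can be nonzero at \<open>f\<close>, so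
  \<open>f \<notin> W\<close> means \<open>L m f \<noteq> 0\<close>; the \<open>L k\<close> are then
  coordinates on \<open>D\<close> itself.\<close>

lemma internal_direct_sum_D:
  assumes "f \<notin> W"
  shows "internal_direct_sum (Ext2 m) D W"
proof -
  have Lf: "L m f \<noteq> 0"
    using assms f_in_Ext2 L_f unfolding W_iff by metis
  have L_D: "L k (a *\<^sub>C f + lincomb (K - {m}) g) = (if k = m then a * L m f else g k)" if "k \<in> K" for a g k
    using that L_f[of k] by (simp add: weight_form_add weight_form_scale L_lincomb)
  have "d = 0" if dD: "d \<in> D" and "d \<in> W" for d
  proof -
    obtain a g where d: "d = a *\<^sub>C f + lincomb (K - {m}) g"
      using dD by (rule D_cases)
    have 0: "(if k = m then a * L m f else g k) = 0" if "k \<in> K" for k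
      using \<open>d \<in> W\<close> that L_D[OF that, of a g] by (simp add: d W_iff)
    have "lincomb (K - {m}) g = 0"
    proof (rule lincomb_zero)
      fix k assume "k \<in> K - {m}"
      then show "g k = 0" using 0[of k] by simp
    qed
    then show ?thesis
      using 0[OF m_in_K] Lf by (simp add: d)
  qed
  moreover have "\<exists>d w. x = d + w \<and> d \<in> D \<and> w \<in> W" if x: "x \<in> Ext2 m" for x
  proof -
    define d where "d = (L m x / L m f) *\<^sub>C f + lincomb (K - {m}) (\<lambda>k. L k x)"
    have d: "d \<in> D" unfolding d_def by (rule in_D)
    have "L k d = L k x" if "k \<in> K" for k
      using Lf unfolding d_def L_D[OF that] by simp
    then have "x - d \<in> W"
      using d D_Ext2 x cvec.subspace_diff[OF subspace_Ext2 x] by (auto simp: W_iff weight_form_diff)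
    then show ?thesis
      using d by (intro exI[of _ d] exI[of _ "x - d"]) simp
  qed
  moreover have "d + w \<in> Ext2 m" if "d \<in> D" "w \<in> W" for d w
    using that D_Ext2 W_Ext2 by (auto intro: cvec.subspace_add[OF subspace_Ext2])
  moreover have "0 \<in> D" "0 \<in> W"
    using cvec.subspace_0 subspace_D subspace_W by blast+
  ultimately show ?thesis
    unfolding internal_direct_sum_def by blast
qed

subsection \<open>The exact sequence\<close>

lemma subspace_null_hyperplane: "cvec.subspace {a \<in> Sym m. L m (wedge v a) = 0}"
  using subspace_Sym[of m]
  by (auto simp: cvec.subspace_def wedge_add_right wedge_scale_right weight_form_add
      weight_form_scale weight_form_zero wedge_zero_right)

lemma ext_form_f_W: "w \<in> W \<Longrightarrow> ext_form m f w = 0"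
  using m_in_K by (simp add: W_iff ext_form_f)

section \<open>Fibres of \<open>N m f\<close> and \<open>F m W\<close>\<close>

lemma bilin_f_swap: "u \<in> Sym m \<Longrightarrow> v \<in> Sym m \<Longrightarrow> bilin m f u v = - L m (wedge v u)"
proof -
  assume uv: "u \<in> Sym m" "v \<in> Sym m"
  have "wedge u v = (- 1) *\<^sub>C wedge v u"
    by (auto simp: wedge_def fun_eq_iff cscale_apply)
  then have "L m (wedge u v) = - 1 * L m (wedge v u)"
    by (simp only: weight_form_scale)
  then show ?thesis
    using uv by (simp add: bilin_f)
qed

text \<open>The kernel condition scales with the point of the line, so testing it at
  \<open>v\<close> is enough.\<close>

lemma num_N:
  assumes v: "v \<in> Sym m - {0}"
  shows "num (N m f) (line v) = {a \<in> Sym m. L m (wedge v a) = 0}"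
proof -
  have "(\<forall>v'\<in>line v - {0}. (\<lambda>_ :: unit. bilin m f a v') \<in> {0}) \<longleftrightarrow> L m (wedge v a) = 0" (is "?l \<longleftrightarrow> ?r")
    if a: "a \<in> Sym m" for a
  proof
    assume ?l
    moreover have "v \<in> line v - {0}"
      using v by (simp add: cvec.span_base)
    ultimately have "(\<lambda>_ :: unit. bilin m f a v) = 0" by blast
    then have "bilin m f a v = 0" by (metis zero_fun_apply)
    then show ?r using v a by (simp add: bilin_f_swap)
  next
    assume r: ?r
    show ?l
    proof
      fix v' assume "v' \<in> line v - {0}"
      then obtain s where s: "v' = s *\<^sub>C v" unfolding line_eq by blast
      then have "v' \<in> Sym m"
        using v cvec.subspace_scale[OF subspace_Sym] by blast
      then have "bilin m f a v' = 0"
        using r a by (simp add: bilin_f_swap s wedge_scale_left weight_form_scale)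
      then show "(\<lambda>_ :: unit. bilin m f a v') \<in> {0}"
        by (simp add: zero_fun_def)
    qed
  qed
  then show ?thesis
    by (auto simp: N_def kernel_bundle_def Q_def cokernel_bundle_def trivial_bundle_def
        O_one_def twisted_def)
qed

lemma den_N:
  assumes v: "v \<in> Sym m - {0}"
  shows "den (N m f) (line v) = line v"
proof -
  have "v \<in> line v - {0}"
    using v by (simp add: cvec.span_base)
  then show ?thesis
    by (auto simp: N_def kernel_bundle_def Q_def cokernel_bundle_def trivial_bundle_def
        O_minus_one_def)
qed

lemma twist_N: "twist (N m f) = 0"
  by (simp add: N_def kernel_bundle_def Q_def cokernel_bundle_def trivial_bundle_def)

lemma num_F: "num (F m W) l = Ext2 m"
  by (simp add: F_def twisted_def cokernel_bundle_def trivial_bundle_def)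

lemma twist_F: "twist (twisted (F m W) 1) = 0"
  by (simp add: F_def twisted_def cokernel_bundle_def trivial_bundle_def)

lemma den_F:
  assumes v: "v \<in> Sym m - {0}"
  shows "den (F m W) (line v) = {w + wedge v a | w a. w \<in> W \<and> a \<in> Sym m}"
proof -
  have "den (F m W) (line v) = {w + wedge v' a | w v' a. w \<in> W \<and> v' \<in> line v - {0} \<and> a \<in> Sym m}"
    by (simp add: F_def twisted_def cokernel_bundle_def trivial_bundle_def Q_def varpi_def)
  also have "\<dots> = {w + wedge v a | w a. w \<in> W \<and> a \<in> Sym m}"
  proof (intro equalityI subsetI)
    fix x assume "x \<in> {w + wedge v' a | w v' a. w \<in> W \<and> v' \<in> line v - {0} \<and> a \<in> Sym m}"
    then obtain w s a where "x = w + wedge (s *\<^sub>C v) a" "w \<in> W" "a \<in> Sym m"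
      unfolding line_eq by blast
    then have "x = w + wedge v (s *\<^sub>C a)" "w \<in> W" "s *\<^sub>C a \<in> Sym m"
      using cvec.subspace_scale[OF subspace_Sym] by (auto simp: wedge_scale_left wedge_scale_right)
    then show "x \<in> {w + wedge v a | w a. w \<in> W \<and> a \<in> Sym m}" by blast
  next
    fix x assume "x \<in> {w + wedge v a | w a. w \<in> W \<and> a \<in> Sym m}"
    moreover have "v \<in> line v - {0}"
      using v by (simp add: cvec.span_base)
    ultimately show "x \<in> {w + wedge v' a | w v' a. w \<in> W \<and> v' \<in> line v - {0} \<and> a \<in> Sym m}"
      by blast
  qed
  finally show ?thesis .
qed

section \<open>Local frames of the null correlation and Tango bundles\<close>

lemma sum_monom_vec_apply:
  assumes "finite J"
  shows "(\<Sum>j\<in>J. g j *\<^sub>C monom_vec j) i = (if i \<in> J then g i else 0)"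
proof -
  have "(\<Sum>j\<in>J. g j *\<^sub>C monom_vec j) i = (\<Sum>j\<in>J. if j = i then g j else 0)"
    unfolding sum_fun_apply by (intro sum.cong refl) (simp add: cscale_apply monom_vec_def)
  then show ?thesis using assms by simp
qed

text \<open>The fibre is a hyperplane in \<open>Sym m\<close>, with equation the sum of
  \<open>\<gamma> j * v (m - j) * a j\<close> equal to zero. Where \<open>v i0 \<noteq> 0\<close> it
  can be solved for the coordinate \<open>m - i0\<close>.\<close>

lemma subbundle_num_N: "subbundle m (num (N m f))"
proof (rule subbundleI)
  fix v0 assume v0: "v0 \<in> Sym m - {0}"
  then obtain i0 where i0: "v0 i0 \<noteq> 0" "i0 \<le> m"
    by (auto simp: Sym_def fun_eq_iff) (metis not_le)
  define j0 where "j0 = m - i0"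
  have j0: "j0 \<le> m" "m - j0 = i0" using i0 by (auto simp: j0_def)
  let ?U = "{v \<in> Sym m - {0}. v i0 \<noteq> 0}" and ?J = "{..m} - {j0}"
  \<comment> \<open>\<open>v i0\<close> times \<open>monom_vec j\<close>, corrected at
    \<open>j0\<close> so as to satisfy the equation.\<close>
  define p where "p j v = (\<lambda>i. v i0 * monom_vec j i - \<gamma> j / \<gamma> j0 * (v (m - j) * monom_vec j0 i))" for j v
  let ?s = "\<lambda>j v. (1 / v i0) *\<^sub>C p j v"
  have p_eq: "p j v = v i0 *\<^sub>C monom_vec j - (\<gamma> j / \<gamma> j0 * v (m - j)) *\<^sub>C monom_vec j0" for j v
    by (auto simp: p_def fun_eq_iff cscale_apply)
  have p_null: "p j v \<in> {a \<in> Sym m. L m (wedge v a) = 0}" if "j \<le> m" for j v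
    using that j0 \<gamma>_nonzero[OF j0(1)] subspace_Sym[of m]
    by (auto simp: p_eq wedge_diff_right wedge_scale_right weight_form_diff weight_form_scale
        L_wedge_monom monom_vec_in_Sym intro!: cvec.subspace_diff cvec.subspace_scale)
  have sum_apply: "(\<Sum>j\<in>?J. g j *\<^sub>C ?s j v) i = (if i \<in> ?J then g i else 0)"
    if "v \<in> ?U" "i \<noteq> j0" for g v i
  proof -
    have "(\<Sum>j\<in>?J. g j *\<^sub>C ?s j v) i = (\<Sum>j\<in>?J. if j = i then g j else 0)"
      unfolding sum_fun_apply using that
      by (intro sum.cong refl) (auto simp: cscale_apply p_def monom_vec_def)
    then show ?thesis by simp
  qed
  have sum_null: "(\<Sum>j\<in>?J. g j *\<^sub>C ?s j v) \<in> {a \<in> Sym m. L m (wedge v a) = 0}" for g v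
    by (intro cvec.subspace_sum[OF subspace_null_hyperplane]
        cvec.subspace_scale[OF subspace_null_hyperplane] p_null) simp
  have "local_frame m (num (N m f)) ?U ?J ?s"
  proof (rule local_frameI)
    show "zariski_open m ?U" by (rule zariski_open_coord)
    show "regular 0 ?U (?s j)" for j
    proof (rule regular_divide_coord)
      fix i
      have "homogeneous_poly 1 (\<lambda>v. monom_vec j i * v i0 - \<gamma> j / \<gamma> j0 * (monom_vec j0 i * v (m - j)))"
        by (intro homogeneous_poly_diff homogeneous_poly_scale hp_coord)
      then show "homogeneous_poly 1 (\<lambda>v. p j v i)"
        by (simp add: p_def mult.commute)
    qed
    show "g j = 0" if "v \<in> ?U" "(\<Sum>j\<in>?J. g j *\<^sub>C ?s j v) = 0" "j \<in> ?J" for v g j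
      using sum_apply[OF that(1), of j g] that(2,3) by simp
    show "\<exists>g. x = (\<Sum>j\<in>?J. g j *\<^sub>C ?s j v)" if v: "v \<in> ?U" and x: "x \<in> num (N m f) (line v)" for v x
    proof
      \<comment> \<open>The frame is the identity in the coordinates other than \<open>j0\<close>,
        so the remainder sits at \<open>j0\<close>, where the equation kills it.\<close>
      define y where "y = x - (\<Sum>j\<in>?J. x j *\<^sub>C ?s j v)"
      have x': "x \<in> {a \<in> Sym m. L m (wedge v a) = 0}"
        using x v num_N[of v] by blast
      then have y: "y \<in> {a \<in> Sym m. L m (wedge v a) = 0}"
        unfolding y_def by (intro cvec.subspace_diff[OF subspace_null_hyperplane] sum_null)
      have "y i = 0" if "i \<noteq> j0" for i
        using sum_apply[OF v that, of x] x' that by (auto simp: y_def Sym_def not_le)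
      then have y_eq: "y = y j0 *\<^sub>C monom_vec j0"
        by (auto simp: fun_eq_iff cscale_apply monom_vec_def)
      have "L m (wedge v (y j0 *\<^sub>C monom_vec j0)) = 0"
        using y y_eq by simp
      then have "y j0 = 0"
        using v j0 \<gamma>_nonzero[OF j0(1)]
        by (simp add: wedge_scale_right weight_form_scale L_wedge_monom)
      then have "y = 0"
        using y_eq by simp
      then show "x = (\<Sum>j\<in>?J. x j *\<^sub>C ?s j v)"
        by (simp add: y_def)
    qed
    show "(\<Sum>j\<in>?J. g j *\<^sub>C ?s j v) \<in> num (N m f) (line v)" if "v \<in> ?U" for v g
      using sum_null num_N[of v] that by blast
  qed simp
  then show "\<exists>U (J :: nat set) s. local_frame m (num (N m f)) U J s \<and> v0 \<in> U"
    using v0 i0 by (intro exI conjI) (assumption, simp)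
qed

text \<open>The fibre is \<open>W\<close> plus the bivectors \<open>wedge v a\<close>. Its rank does
  not depend on \<open>v\<close>, because \<open>W\<close> contains no nonzero bivector of that
  form.\<close>

lemma subbundle_den_F: "subbundle m (den (F m W))"
proof (rule subbundleI)
  fix v0 assume v0: "v0 \<in> Sym m - {0}"
  then obtain j0 where j0: "v0 j0 \<noteq> 0"
    by (auto simp: fun_eq_iff)
  let ?U = "{v \<in> Sym m - {0}. v j0 \<noteq> 0}" and ?J = "{..m} - {j0}"
  from finite_basis_Ext2[OF subspace_W W_Ext2] obtain B where
    "finite B \<and> (\<forall>g. (\<Sum>b\<in>B. g b *\<^sub>C b) = 0 \<longrightarrow> (\<forall>b\<in>B. g b = 0)) \<and>
      W = {\<Sum>b\<in>B. g b *\<^sub>C b | g. True}" ..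
  then have finB: "finite B" and indepB: "\<And>g b. (\<Sum>b\<in>B. g b *\<^sub>C b) = 0 \<Longrightarrow> b \<in> B \<Longrightarrow> g b = 0"
    and W_span: "W = {\<Sum>b\<in>B. g b *\<^sub>C b | g. True}"
    by simp_all
  \<comment> \<open>The index \<open>j0\<close> is omitted, since modulo \<open>v\<close> every
    \<open>a\<close> can be given a zero entry there.\<close>
  define s where "s i v = (case i of Inl b \<Rightarrow> b | Inr j \<Rightarrow> (1 / v j0) *\<^sub>C wedge v (monom_vec j))" for i v
  define u where "u g v = (1 / v j0) *\<^sub>C (\<Sum>j\<in>?J. g j *\<^sub>C monom_vec j)" for g and v :: cvector
  have sum_s: "(\<Sum>i\<in>B <+> ?J. g i *\<^sub>C s i v) = (\<Sum>b\<in>B. g (Inl b) *\<^sub>C b) + wedge v (u (\<lambda>j. g (Inr j)) v)" for g v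
    unfolding u_def wedge_scale_right wedge_sum_right cvec.scale_sum_right
    using finB by (simp add: sum.Plus s_def wedge_scale_right mult.commute)
  have u_apply: "u g v i = (if i \<in> ?J then g i / v j0 else 0)" for g v i
    by (simp add: u_def cscale_apply sum_monom_vec_apply)
  have u_Sym: "u g v \<in> Sym m" for g v
    by (auto simp: Sym_def u_apply)
  have "local_frame m (den (F m W)) ?U (B <+> ?J) s"
  proof (rule local_frameI)
    show "zariski_open m ?U" by (rule zariski_open_coord)
    show "regular 0 ?U (s i)" for i
    proof (cases i)
      case (Inl b)
      then have "s i = (\<lambda>_. b)" by (auto simp: s_def fun_eq_iff)
      then show ?thesis by (simp add: regular_const)
    next
      case (Inr j)
      have "homogeneous_poly 1 (\<lambda>v. wedge v (monom_vec j) y)" for y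
        using homogeneous_poly_wedge[OF hp_coord hp_const] by simp
      then have "regular 0 ?U (\<lambda>v. (1 / v j0) *\<^sub>C wedge v (monom_vec j))"
        by (rule regular_divide_coord)
      moreover have "s i = (\<lambda>v. (1 / v j0) *\<^sub>C wedge v (monom_vec j))"
        by (simp add: s_def Inr fun_eq_iff)
      ultimately show ?thesis by simp
    qed
    show "finite (B <+> ?J)" using finB by simp
    show "g i = 0" if v: "v \<in> ?U" and 0: "(\<Sum>i\<in>B <+> ?J. g i *\<^sub>C s i v) = 0" and i: "i \<in> B <+> ?J" for v g i
    proof -
      let ?w = "\<Sum>b\<in>B. g (Inl b) *\<^sub>C b" and ?a = "u (\<lambda>j. g (Inr j)) v"
      have "?w \<in> W" unfolding W_span by (intro CollectI exI[of _ "\<lambda>b. g (Inl b)"]) simp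
      then have "- ?w \<in> W" using cvec.subspace_neg[OF subspace_W] by blast
      moreover have "wedge v ?a = - ?w"
        using 0 unfolding sum_s by (simp add: eq_neg_iff_add_eq_0 add.commute)
      ultimately have "wedge v ?a = 0"
        using v u_Sym by (intro indecomposable) auto
      then have "?a \<in> line v" "?w = 0"
        using wedge_eq_0_imp_in_line[of v ?a] v \<open>wedge v ?a = - ?w\<close> by simp_all
      then obtain t where t: "?a = t *\<^sub>C v" unfolding line_eq by blast
      \<comment> \<open>\<open>?a\<close> has no entry at \<open>j0\<close>, while \<open>v\<close>
        has one.\<close>
      have "t * v j0 = 0"
        using fun_cong[OF t, of j0] by (simp add: u_apply cscale_apply)
      then have "t = 0" using v by simp
      then have "?a j = 0" for j
        using t by (simp add: cscale_apply)
      then have "g (Inr j) / v j0 = 0" if "j \<in> ?J" for j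
        using that by (metis u_apply)
      then have "g (Inr j) = 0" if "j \<in> ?J" for j
        using that v by simp
      moreover have "g (Inl b) = 0" if "b \<in> B" for b
        using indepB[OF \<open>?w = 0\<close> that] .
      ultimately show ?thesis
        using i by auto
    qed
    show "\<exists>g. x = (\<Sum>i\<in>B <+> ?J. g i *\<^sub>C s i v)" if v: "v \<in> ?U" and x: "x \<in> den (F m W) (line v)" for v x
    proof -
      from x v obtain w a where wa: "x = w + wedge v a" "w \<in> W" "a \<in> Sym m"
        using den_F[of v] by blast
      from wa(2) obtain h where h: "w = (\<Sum>b\<in>B. h b *\<^sub>C b)"
        unfolding W_span by blast
      \<comment> \<open>The entries of \<open>a - (a j0 / v j0) *\<^sub>C v\<close>, which has none
        at \<open>j0\<close>, times the factor \<open>v j0\<close> by which \<open>u\<close>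
        divides.\<close>
      define g where "g i = (case i of Inl b \<Rightarrow> h b | Inr j \<Rightarrow> v j0 * a j - a j0 * v j)" for i
      have "u (\<lambda>j. g (Inr j)) v = a - (a j0 / v j0) *\<^sub>C v"
      proof
        fix i
        show "u (\<lambda>j. g (Inr j)) v i = (a - (a j0 / v j0) *\<^sub>C v) i"
          using v wa(3) by (auto simp: u_apply g_def cscale_apply Sym_def field_simps)
      qed
      then have "wedge v (u (\<lambda>j. g (Inr j)) v) = wedge v a"
        by (simp add: wedge_diff_right wedge_scale_right wedge_self)
      then have "x = (\<Sum>i\<in>B <+> ?J. g i *\<^sub>C s i v)"
        unfolding sum_s by (simp add: wa(1) h g_def)
      then show ?thesis by (rule exI[of _ g])
    qed
    show "(\<Sum>i\<in>B <+> ?J. g i *\<^sub>C s i v) \<in> den (F m W) (line v)" if v: "v \<in> ?U" for v g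
    proof -
      have "(\<Sum>b\<in>B. g (Inl b) *\<^sub>C b) \<in> W"
        unfolding W_span by (intro CollectI exI[of _ "\<lambda>b. g (Inl b)"]) simp
      then show ?thesis
        unfolding sum_s using den_F[of v] v u_Sym by blast
    qed
  qed
  then show "\<exists>U (J :: (cbivector + nat) set) s. local_frame m (den (F m W)) U J s \<and> v0 \<in> U"
    using v0 j0 by (intro exI conjI) (assumption, simp)
qed

lemma subbundle_den_N: "subbundle m (den (N m f))"
  using subbundle_cong[of m "den (N m f)" "\<lambda>l. l"] subbundle_line den_N by blast

section \<open>The two maps of the sequence\<close>

lemma \<phi>_in_D: "\<phi> v a \<in> D"
  unfolding \<phi>_def by (rule lincomb_in_D)

lemma \<psi>_in_Ext2: "\<psi> v x \<in> Ext2 m"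
  unfolding \<psi>_def by (rule lincomb_in_Ext2) blast

lemma L_\<psi>: "k \<in> K \<Longrightarrow> L k (\<psi> v x) = (if k = m then 0 else x (lead m k))"
  unfolding \<psi>_def by (subst L_lincomb) auto

lemma \<phi>_lead: "k \<in> K \<Longrightarrow> \<phi> v a (lead m k) = (if k = m then 0 else L k (wedge v a))"
  unfolding \<phi>_def by (subst lincomb_lead) auto

lemma \<psi>_f: "\<psi> v (t *\<^sub>C f) = 0"
  unfolding \<psi>_def using f_lead by (intro lincomb_zero) (simp add: cscale_apply)

lemma \<phi>_line: "a \<in> line v \<Longrightarrow> \<phi> v a = 0"
  unfolding line_eq \<phi>_def
  by (intro lincomb_zero) (auto simp: wedge_scale_right wedge_self weight_form_scale weight_form_zero)

lemma homogeneous_poly_\<phi>: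
  assumes "\<And>i. homogeneous_poly e (\<lambda>v. p v i)"
  shows "homogeneous_poly (e + 1) (\<lambda>v. \<phi> v (p v) y)"
proof -
  have "homogeneous_poly (1 + e) (\<lambda>v. wedge v (p v) z)" for z
    by (intro homogeneous_poly_wedge hp_coord assms)
  then have "homogeneous_poly (e + 1) (\<lambda>v. \<Sum>k\<in>K - {m}. basis_wedge (lead m k) y * L k (wedge v (p v)))"
    unfolding weight_form_def
    by (intro homogeneous_poly_sum homogeneous_poly_scale) (simp add: add.commute)
  then show ?thesis
    by (simp add: \<phi>_def lincomb_def sum_fun_apply cscale_apply mult.commute)
qed

lemma homogeneous_poly_\<psi>:
  assumes "\<And>i. homogeneous_poly e (\<lambda>v. p v i)"
  shows "homogeneous_poly e (\<lambda>v. \<psi> v (p v) y)"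
proof -
  have "homogeneous_poly e (\<lambda>v. \<Sum>k\<in>K - {m}. basis_wedge (lead m k) y * p v (lead m k))"
    by (intro homogeneous_poly_sum homogeneous_poly_scale assms)
  then show ?thesis
    by (simp add: \<psi>_def lincomb_def sum_fun_apply cscale_apply mult.commute)
qed

text \<open>\<open>\<phi>\<close> has degree one in the point; the twist by \<open>- 1\<close> of
  the source absorbs it.\<close>

lemma bundle_morphism_\<phi>:
  "bundle_morphism m (twisted (N m f) (- 1)) (trivial_bundle D (cvec.span {f})) \<phi>"
proof (rule bundle_morphismI[where \<delta> = 1])
  fix v a assume "v \<in> Sym m - {0}" "a \<in> den (twisted (N m f) (- 1)) (line v)"
  then have "\<phi> v a = 0"
    by (intro \<phi>_line) (simp add: twisted_def den_N)
  then show "\<phi> v a \<in> den (trivial_bundle D (cvec.span {f})) (line v)"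
    by (simp add: trivial_bundle_def cvec.span_zero)
next
  show "\<phi> v (a + b) = \<phi> v a + \<phi> v b" for v a b
    by (simp add: \<phi>_def wedge_add_right weight_form_add lincomb_add)
  show "\<phi> v (s *\<^sub>C a) = s *\<^sub>C \<phi> v a" for v s a
    by (simp add: \<phi>_def wedge_scale_right weight_form_scale lincomb_scale)
  show "\<phi> (s *\<^sub>C v) a = s ^ 1 *\<^sub>C \<phi> v a" for v s a
    by (simp add: \<phi>_def wedge_scale_left weight_form_scale lincomb_scale)
qed (auto simp: trivial_bundle_def twisted_def twist_N cvec.span_zero \<phi>_in_D
    intro: homogeneous_poly_\<phi>[simplified])

lemma zero_in_den_F: "v \<in> Sym m - {0} \<Longrightarrow> 0 \<in> den (F m W) (line v)"
proof -
  assume v: "v \<in> Sym m - {0}"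
  have "0 = 0 + wedge v v" by (simp add: wedge_self)
  then show ?thesis
    unfolding den_F[OF v] using v cvec.subspace_0[OF subspace_W] by blast
qed

lemma bundle_morphism_\<psi>:
  "bundle_morphism m (trivial_bundle D (cvec.span {f})) (twisted (F m W) 1) \<psi>"
proof (rule bundle_morphismI[where \<delta> = 0])
  fix v x assume v: "v \<in> Sym m - {0}" and "x \<in> den (trivial_bundle D (cvec.span {f})) (line v)"
  then have "\<psi> v x = 0"
    using \<psi>_f by (auto simp: trivial_bundle_def line_eq)
  then show "\<psi> v x \<in> den (twisted (F m W) 1) (line v)"
    using v by (simp add: twisted_def zero_in_den_F)
next
  show "\<psi> v (a + b) = \<psi> v a + \<psi> v b" for v a b
    by (simp add: \<psi>_def lincomb_add)
  show "\<psi> v (s *\<^sub>C a) = s *\<^sub>C \<psi> v a" for v s a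
    by (simp add: \<psi>_def lincomb_scale cscale_apply)
  show "\<psi> (s *\<^sub>C v) a = s ^ 0 *\<^sub>C \<psi> v a" for v s a
    by (simp add: \<psi>_def)
  show "homogeneous_poly (e + 0) (\<lambda>v. \<psi> v (p v) y)" if "\<And>i. homogeneous_poly e (\<lambda>v. p v i)" for e p y
    using homogeneous_poly_\<psi>[of e p y] that by simp
  show "twist (twisted (F m W) 1) = twist (trivial_bundle D (cvec.span {f})) + int 0"
    by (simp add: twist_F trivial_bundle_def)
qed (auto simp: twisted_def num_F \<psi>_in_Ext2 zero_in_den_F)

section \<open>Exactness on fibres\<close>

lemma exact_injective:
  assumes v: "v \<in> Sym m - {0}" and a: "a \<in> Sym m" "L m (wedge v a) = 0"
    and \<phi>: "\<phi> v a \<in> cvec.span {f}"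
  shows "a \<in> line v"
proof -
  obtain t where t: "\<phi> v a = t *\<^sub>C f"
    using \<phi> unfolding line_eq by blast
  \<comment> \<open>In weight \<open>m\<close> because \<open>a\<close> is in the fibre of
    \<open>N m f\<close>; in the others because \<open>f\<close> has no entry at their
    leads.\<close>
  have "L k (wedge v a) = 0" if "k \<in> K" for k
    using \<phi>_lead[OF that, of v a] f_lead[OF that] a(2) t by (cases "k = m") (auto simp: cscale_apply)
  then have "wedge v a \<in> W"
    using v a(1) by (simp add: W_iff wedge_in_Ext2)
  then have "wedge v a = 0"
    using v a(1) by (intro indecomposable) auto
  then show ?thesis
    using v by (intro wedge_eq_0_imp_in_line) auto
qed

text \<open>Both sides say that some \<open>a\<close> has \<open>L k (wedge v a)\<close> equal to
  the lead entry of \<open>x\<close> for \<open>k \<noteq> m\<close> and to zero for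
  \<open>k = m\<close>. Then \<open>\<psi> v x\<close> and \<open>wedge v a\<close> agree modulo
  \<open>W\<close>, and \<open>x - \<phi> v a\<close> keeps only its lead entry of weight
  \<open>m\<close>, so it is a multiple of \<open>f\<close>.\<close>

lemma exact_middle:
  assumes v: "v \<in> Sym m - {0}" and x: "x \<in> D"
  shows "\<psi> v x \<in> den (F m W) (line v) \<longleftrightarrow>
    (\<exists>a\<in>{a \<in> Sym m. L m (wedge v a) = 0}. x - \<phi> v a \<in> cvec.span {f})"
proof
  assume "\<psi> v x \<in> den (F m W) (line v)"
  then obtain w a where wa: "\<psi> v x = w + wedge v a" "w \<in> W" "a \<in> Sym m"
    unfolding den_F[OF v] by blast
  have L: "L k (wedge v a) = (if k = m then 0 else x (lead m k))" if "k \<in> K" for k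
    using L_\<psi>[OF that, of v x] wa(2) that unfolding wa(1) by (simp add: weight_form_add W_iff)
  have "x - \<phi> v a = (x (lead m m) / f (lead m m)) *\<^sub>C f"
  proof (rule D_eqI)
    show "x - \<phi> v a \<in> D" "(x (lead m m) / f (lead m m)) *\<^sub>C f \<in> D"
      using x \<phi>_in_D f_in_D cvec.subspace_diff[OF subspace_D] cvec.subspace_scale[OF subspace_D]
      by blast+
    show "(x - \<phi> v a) (lead m k) = ((x (lead m m) / f (lead m m)) *\<^sub>C f) (lead m k)" if "k \<in> K" for k
      using that f_lead[OF that] by (auto simp: \<phi>_lead L cscale_apply)
  qed
  then have "x - \<phi> v a \<in> cvec.span {f}"
    unfolding line_eq by blast
  then show "\<exists>a\<in>{a \<in> Sym m. L m (wedge v a) = 0}. x - \<phi> v a \<in> cvec.span {f}"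
    using wa(3) L[OF m_in_K] by auto
next
  assume "\<exists>a\<in>{a \<in> Sym m. L m (wedge v a) = 0}. x - \<phi> v a \<in> cvec.span {f}"
  then obtain a t where a: "a \<in> Sym m" "L m (wedge v a) = 0" and t: "x - \<phi> v a = t *\<^sub>C f"
    unfolding line_eq by blast
  have "L k (\<psi> v x - wedge v a) = 0" if "k \<in> K" for k
    using fun_cong[OF t, of "lead m k"] that f_lead[OF that] a(2)
    by (cases "k = m") (auto simp: weight_form_diff L_\<psi> \<phi>_lead cscale_apply)
  then have "\<psi> v x - wedge v a \<in> W"
    using v a(1) cvec.subspace_diff[OF subspace_Ext2 \<psi>_in_Ext2 wedge_in_Ext2] by (auto simp: W_iff)
  moreover have "\<psi> v x = (\<psi> v x - wedge v a) + wedge v a" by simp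
  ultimately show "\<psi> v x \<in> den (F m W) (line v)"
    unfolding den_F[OF v] using a(1) by blast
qed

text \<open>\<open>L m x\<close> need not vanish, but nondegeneracy of \<open>f\<close> yields a
  bivector \<open>wedge v a\<close>, zero in the cokernel, with the same value of
  \<open>L m\<close>. Subtracting it leaves, modulo \<open>W\<close>, a combination of leads of the
  other weights, which \<open>\<psi>\<close> reaches.\<close>

lemma exact_surjective:
  assumes v: "v \<in> Sym m - {0}" and x: "x \<in> Ext2 m"
  shows "\<exists>b\<in>D. x - \<psi> v b \<in> den (F m W) (line v)"
proof -
  obtain i0 where i0: "v i0 \<noteq> 0" "i0 \<le> m"
    using v by (auto simp: Sym_def fun_eq_iff) (metis not_le)
  define e where "e = monom_vec (m - i0)"
  have e: "e \<in> Sym m" by (simp add: e_def monom_vec_in_Sym)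
  have Le: "L m (wedge v e) \<noteq> 0"
    using i0 \<gamma>_nonzero[of "m - i0"] by (simp add: e_def L_wedge_monom)
  define a where "a = (L m x / L m (wedge v e)) *\<^sub>C e"
  have a: "a \<in> Sym m" unfolding a_def by (rule cvec.subspace_scale[OF subspace_Sym e])
  have La: "L m (wedge v a) = L m x"
    using Le by (simp add: a_def wedge_scale_right weight_form_scale)
  define b where "b = lincomb (K - {m}) (\<lambda>k. L k (x - wedge v a))"
  have b: "b \<in> D" unfolding b_def by (rule lincomb_in_D)
  have "L k (x - \<psi> v b - wedge v a) = 0" if k: "k \<in> K" for k
  proof -
    have "b (lead m k) = (if k = m then 0 else L k (x - wedge v a))"
      unfolding b_def using k by (subst lincomb_lead) auto
    then show ?thesis
      using k La by (auto simp: weight_form_diff L_\<psi>)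
  qed
  moreover have "x - \<psi> v b - wedge v a \<in> Ext2 m"
    using v a x by (intro cvec.subspace_diff[OF subspace_Ext2] \<psi>_in_Ext2 wedge_in_Ext2) auto
  ultimately have "x - \<psi> v b - wedge v a \<in> W"
    by (simp add: W_iff)
  moreover have "x - \<psi> v b = (x - \<psi> v b - wedge v a) + wedge v a" by simp
  ultimately have "x - \<psi> v b \<in> den (F m W) (line v)"
    unfolding den_F[OF v] using a by blast
  then show ?thesis using b by blast
qed

lemma span_f_D: "cvec.span {f} \<subseteq> D"
  using f_in_D subspace_D by (intro cvec.span_minimal) auto

lemma short_exact_sequence:
  "short_exact m (twisted (N m f) (- 1)) \<phi> (trivial_bundle D (cvec.span {f})) \<psi> (twisted (F m W) 1)"
  unfolding short_exact_def
proof (intro conjI ballI bundle_morphism_\<phi> bundle_morphism_\<psi>)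
  \<comment> \<open>The form is alternating, so the line of \<open>v\<close> lies in its own
    hyperplane: \<open>den\<close> is inside \<open>num\<close>.\<close>
  have line_null: "line v \<subseteq> {a \<in> Sym m. L m (wedge v a) = 0}" if "v \<in> Sym m - {0}" for v
    using that by (intro cvec.span_minimal subspace_null_hyperplane)
      (auto simp: wedge_self weight_form_zero)
  show "vector_bundle m (twisted (N m f) (- 1))"
    using subbundle_num_N subbundle_den_N line_null num_N den_N
    by (simp add: vector_bundle_def twisted_def)
  show "vector_bundle m (trivial_bundle D (cvec.span {f}))"
    using span_f_D D_Ext2 subspace_D
    by (auto simp: vector_bundle_def trivial_bundle_def intro!: subbundle_const)
  have "num (F m W) = (\<lambda>_. Ext2 m)"
    by (rule ext) (rule num_F)
  moreover have "den (F m W) (line v) \<subseteq> Ext2 m" if "v \<in> Sym m - {0}" for v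
    using that W_Ext2 unfolding den_F[OF that]
    by (auto intro!: cvec.subspace_add[OF subspace_Ext2] wedge_in_Ext2)
  ultimately show "vector_bundle m (twisted (F m W) 1)"
    using subbundle_const[OF subspace_Ext2 subset_refl] subbundle_den_F
    by (simp add: vector_bundle_def twisted_def)
next
  fix v assume v: "v \<in> Sym m - {0}"
  show "\<phi> v a \<in> den (trivial_bundle D (cvec.span {f})) (line v) \<longrightarrow> a \<in> den (twisted (N m f) (- 1)) (line v)"
    if "a \<in> num (twisted (N m f) (- 1)) (line v)" for a
    using that exact_injective[OF v, of a] num_N[OF v] den_N[OF v]
    by (auto simp: twisted_def trivial_bundle_def)
  show "\<psi> v x \<in> den (twisted (F m W) 1) (line v) \<longleftrightarrow>
      (\<exists>a\<in>num (twisted (N m f) (- 1)) (line v). x - \<phi> v a \<in> den (trivial_bundle D (cvec.span {f})) (line v))"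
    if "x \<in> num (trivial_bundle D (cvec.span {f})) (line v)" for x
    using that exact_middle[OF v, of x] num_N[OF v] by (simp add: twisted_def trivial_bundle_def)
  show "\<exists>b\<in>num (trivial_bundle D (cvec.span {f})) (line v). x - \<psi> v b \<in> den (twisted (F m W) 1) (line v)"
    if "x \<in> num (twisted (F m W) 1) (line v)" for x
    using that exact_surjective[OF v, of x] num_F by (simp add: twisted_def trivial_bundle_def)
qed

end

theorem mainTheorem4:
  fixes n \<alpha> :: nat and \<beta> :: int and W :: "cbivector set"
  assumes "n > 0" and "\<beta> \<le> int \<alpha>" and "int \<alpha> + \<beta> \<ge> 0"
    and "W \<in> tango_subspaces n"
  shows "\<exists>f \<in> Ext2 (2 * n + 1).
    nondegenerate (2 * n + 1) f \<and>
    (\<forall>t. t \<noteq> 0 \<longrightarrow> (\<exists>a. a \<noteq> 0 \<and> (\<forall>u\<in>Sym (2 * n + 1). \<forall>v\<in>Sym (2 * n + 1).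
      bilin (2 * n + 1) f (sigma1 \<alpha> \<beta> (2 * n + 1) t u) (sigma1 \<alpha> \<beta> (2 * n + 1) t v) =
        a * bilin (2 * n + 1) f u v))) \<and>
    (\<forall>w\<in>W. ext_form (2 * n + 1) f w = 0) \<and>
    special n f \<and>
    (\<exists>D. torus_invariant (2 * n + 1) D \<and> f \<in> D \<and>
      (\<exists>\<Phi>. direct_sum_iso (2 * n + 1) D W \<Phi>) \<and>
      (f \<notin> W \<longrightarrow> internal_direct_sum (Ext2 (2 * n + 1)) D W) \<and>
      (\<exists>\<phi> \<psi>. short_exact (2 * n + 1)
        (twisted (N (2 * n + 1) f) (- 1)) \<phi>
        (trivial_bundle D (cvec.span {f})) \<psi>
        (twisted (F (2 * n + 1) W) 1)))"
proof -
  from tango_subspace_hyperplanes[OF assms(1,4)] obtain c where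
    "(\<forall>y\<in>pairs (2 * n + 1). c y \<noteq> 0) \<and> (\<forall>k\<in>{1..2 * (2 * n + 1) - 1}. c (lead (2 * n + 1) k) = 1) \<and>
      W = {x \<in> Ext2 (2 * n + 1). \<forall>k\<in>{1..2 * (2 * n + 1) - 1}. weight_form (2 * n + 1) c k x = 0}" ..
  moreover have "wedge u v = 0"
    if "u \<in> Sym (2 * n + 1)" "v \<in> Sym (2 * n + 1)" "wedge u v \<in> W" for u v
    using assms(4) that by (auto simp: tango_subspaces_def)
  ultimately interpret tango_hyperplanes n "2 * n + 1" c W
    by (intro tango_hyperplanes.intro) blast+
  show ?thesis
    using f_in_Ext2 nondegenerate_f ext_form_f_W bilin_sigma1 special_f torus_invariant_D f_in_D
      direct_sum_iso_\<Phi> internal_direct_sum_D short_exact_sequence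
    by blast
qed

end
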